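(* Let $q$ be a power of a prime and $n$ a positive integer with $\gcd(n,q)=1$. With the notation $f_j,\alpha_j,r,s,\delta$ of the context, the group algebra $\mathbb F_q D_{2n}$ has Wedderburn decomposition of the form $$\mathbb F_q D_{2n}\cong\bigoplus_{j=1}^{r+s}A_j,$$ where $$A_j=\begin{cases}\mathbb F_q\oplus\mathbb F_q & \text{if } j\le\delta,\\ M_2(\mathbb F_q[\alpha_j+\alpha_j^{-1}]) & \text{if } \delta+1\le j\le r,\\ M_2(\mathbb F_q[\alpha_j]) & \text{if } r+1\le j\le r+s.\end{cases}$$
   Context: $\mathbb F_q$ is the finite field with $q$ elements. $D_{2n}=\langle x,y\mid x^n=1,\ y^2=1,\ xy=yx^{-1}\rangle$ is the dihedral group of order $2n$. For a polynomial $g\in\mathbb F_q[x]$ with $g(0)\neq0$, its reciprocal polynomial is $g^*(x)=x^{\deg g}g(1/x)$. The polynomial $x^n-1$ splits into monic irreducible factors in $\mathbb F_q[x]$ as $$x^n-1=f_1f_2\cdots f_r\,f_{r+1}f_{r+1}^*f_{r+2}f_{r+2}^*\cdots f_{r+s}f_{r+s}^*,$$ where reciprocals are taken up to a nonzero scalar (normalized to be monic), $f_1=x-1$, $f_2=x+1$ if $n$ is even, $f_j^*=f_j$ for $2\le j\le r$, $r$ is the number of auto-reciprocal factors in the factorization (counting $f_1=x-1$), and $2s$ is the number of non-auto-reciprocal factors. For each $j$, $\alpha_j$ denotes a root of $f_j$. Define $\epsilon=0$ if $\operatorname{char}(\mathbb F_q)=2$, $\epsilon=1$ if $\operatorname{char}(\mathbb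 F_q)\neq2$ and $n$ is odd, $\epsilon=2$ if $\operatorname{char}(\mathbb F_q)\ne2$ and $n$ is even, and $\delta=\max\{\epsilon,1\}$. $M_2(K)$ denotes the algebra of $2\times2$ matrices over $K$.
   Formalization: In characteristic 2 the claim is false as stated (the group algebra is not semisimple, e.g. q=2, n=1), so there A_1 is replaced by the group algebra F_q C_2 = F_q[y]/(y^2-1); all other blocks, and the whole claim in odd characteristic, are as stated. *)

theory Defs
  imports
    "HOL-Analysis.Cartesian_Space"
    "HOL-Algebra.QuotRing"
    "HOL-Algebra.Generated_Groups"
    "HOL-Algebra.Algebraic_Closure_Type"
begin

section \<open>The dihedral group\<close>

text \<open>
  The pair \<open>(i, b)\<close> with \<open>0 \<le> i < n\<close> stands for \<open>x^i\<close> if \<open>b\<close> is false and for \<open>x^i y\<close> if \<open>b\<close> is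
  true; the multiplication comes from \<open>y x^j = x^(-j) y\<close> and \<open>y^2 = 1\<close>. The lemmas below show that
  this is the group of order \<open>2n\<close> given by the usual presentation. For \<open>n = 1\<close> and \<open>n = 2\<close> it is
  \<open>C\<^sub>2\<close> and \<open>C\<^sub>2 \<times> C\<^sub>2\<close>.
\<close>

definition dihedral_group :: "nat \<Rightarrow> (int \<times> bool) monoid" where
  "dihedral_group n =
    \<lparr>carrier = {0..<int n} \<times> UNIV,
     monoid.mult = (\<lambda>(i, b) (j, c). ((if b then i - j else i + j) mod int n, b \<noteq> c)),
     monoid.one = (0, False)\<rparr>"

definition dihedral_x :: "nat \<Rightarrow> int \<times> bool" where
  "dihedral_x n = (1 mod int n, False)"

definition dihedral_y :: "int \<times> bool" where
  "dihedral_y = (0, True)"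

lemma group_dihedral_group:
  assumes "n > 0"
  shows "group (dihedral_group n)"
proof (rule groupI)
  fix u v w
  assume u: "u \<in> carrier (dihedral_group n)" and v: "v \<in> carrier (dihedral_group n)"
    and w: "w \<in> carrier (dihedral_group n)"
  show "u \<otimes>\<^bsub>dihedral_group n\<^esub> v \<otimes>\<^bsub>dihedral_group n\<^esub> w
      = u \<otimes>\<^bsub>dihedral_group n\<^esub> (v \<otimes>\<^bsub>dihedral_group n\<^esub> w)"
    by (cases u; cases v; cases w)
      (auto simp: dihedral_group_def mod_simps algebra_simps)
next
  fix u assume u: "u \<in> carrier (dihedral_group n)"
  obtain i b where [simp]: "u = (i, b)" by (cases u)
  show "\<exists>v\<in>carrier (dihedral_group n). v \<otimes>\<^bsub>dihedral_group n\<^esub> u = \<one>\<^bsub>dihedral_group n\<^esub>"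
    using assms u
    by (intro bexI[of _ "if b then (i, True) else ((- i) mod int n, False)"])
      (auto simp: dihedral_group_def mod_simps)
qed (use assms in \<open>auto simp: dihedral_group_def split: if_splits\<close>)

lemma order_dihedral_group: "Coset.order (dihedral_group n) = 2 * n"
  by (simp add: Coset.order_def dihedral_group_def)

lemma dihedral_x_pow:
  assumes "n > 0"
  shows "dihedral_x n [^]\<^bsub>dihedral_group n\<^esub> (k::nat) = (int k mod int n, False)"
  by (induction k) (auto simp: nat_pow_def dihedral_group_def dihedral_x_def mod_simps algebra_simps)

lemma dihedral_relations:
  assumes "n > 0"
  defines "D \<equiv> dihedral_group n" and "x \<equiv> dihedral_x n" and "y \<equiv> dihedral_y"
  shows "x [^]\<^bsub>D\<^esub> n = \<one>\<^bsub>D\<^esub>" and "y [^]\<^bsub>D\<^esub> (2::nat) = \<one>\<^bsub>D\<^esub>"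
    and "x \<otimes>\<^bsub>D\<^esub> y = y \<otimes>\<^bsub>D\<^esub> inv\<^bsub>D\<^esub> x"
    and "generate D {x, y} = carrier D"
proof -
  interpret group D unfolding D_def by (rule group_dihedral_group) fact
  have x: "x \<in> carrier D" and y: "y \<in> carrier D"
    using assms by (auto simp: dihedral_group_def dihedral_x_def dihedral_y_def)
  show "x [^]\<^bsub>D\<^esub> n = \<one>\<^bsub>D\<^esub>"
    using dihedral_x_pow[OF assms(1)] by (simp add: D_def x_def dihedral_group_def)
  show "y [^]\<^bsub>D\<^esub> (2::nat) = \<one>\<^bsub>D\<^esub>"
    by (simp add: numeral_2_eq_2 D_def y_def dihedral_y_def dihedral_group_def)
  have "x \<otimes>\<^bsub>D\<^esub> y \<otimes>\<^bsub>D\<^esub> x = y"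
    by (simp add: D_def x_def y_def dihedral_x_def dihedral_y_def dihedral_group_def)
  moreover have "y \<otimes>\<^bsub>D\<^esub> y = \<one>\<^bsub>D\<^esub>"
    by (simp add: D_def y_def dihedral_y_def dihedral_group_def)
  ultimately show "x \<otimes>\<^bsub>D\<^esub> y = y \<otimes>\<^bsub>D\<^esub> inv\<^bsub>D\<^esub> x"
    by (metis x y inv_solve_right m_closed)
  show "generate D {x, y} = carrier D"
  proof
    show "generate D {x, y} \<subseteq> carrier D"
      using x y by (intro generate_incl) auto
    interpret S: subgroup "generate D {x, y}" D
      using x y by (intro generate_is_subgroup) auto
    have pow: "x [^]\<^bsub>D\<^esub> (k::nat) \<in> generate D {x, y}" for k
      by (induction k) (auto intro: generate.intros)
    show "carrier D \<subseteq> generate D {x, y}"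
    proof
      fix u assume u: "u \<in> carrier D"
      obtain i b where ib: "u = (i, b)" by (cases u)
      have i: "0 \<le> i" "i < int n"
        using u ib by (auto simp: D_def dihedral_group_def)
      have pi: "x [^]\<^bsub>D\<^esub> nat i = (i, False)"
        using dihedral_x_pow[OF assms(1), of "nat i"] i by (simp add: D_def x_def)
      show "u \<in> generate D {x, y}"
      proof (cases b)
        case True
        have "u = x [^]\<^bsub>D\<^esub> nat i \<otimes>\<^bsub>D\<^esub> y"
          using i unfolding pi by (simp add: ib True D_def y_def dihedral_y_def dihedral_group_def)
        then show ?thesis
          using pow generate.incl[of y "{x, y}" D] by (simp add: generate.eng)
      next
        case False
        then show ?thesis using pow[of "nat i"] pi ib by simp
      qed
    qed
  qed
qed


section \<open>Algebras over a field given as a type\<close>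

text \<open>
  An algebra over the field \<open>'a\<close> is a (not necessarily commutative) ring with a scalar
  multiplication; the library's record type for modules carries exactly these operations.
\<close>

type_synonym ('a, 'b) alg = "('a, 'b) module"

definition alg_iso :: "('a, 'b) alg \<Rightarrow> ('a, 'c) alg \<Rightarrow> bool" (infixl "\<cong>\<^sub>a" 60) where
  "A \<cong>\<^sub>a B \<longleftrightarrow>
    (\<exists>h \<in> ring_iso A B. \<forall>c. \<forall>u\<in>carrier A. h (c \<odot>\<^bsub>A\<^esub> u) = c \<odot>\<^bsub>B\<^esub> h u)"

definition alg_sum :: "'i set \<Rightarrow> ('i \<Rightarrow> ('a, 'b) alg) \<Rightarrow> ('a, 'i \<Rightarrow> 'b) alg" where
  \<comment> \<open>the direct sum of a finite family, i.e. the product with componentwise operations\<close>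
  "alg_sum I A =
    \<lparr>carrier = (\<Pi>\<^sub>E i\<in>I. carrier (A i)),
     monoid.mult = (\<lambda>u v. \<lambda>i\<in>I. u i \<otimes>\<^bsub>A i\<^esub> v i),
     monoid.one = (\<lambda>i\<in>I. \<one>\<^bsub>A i\<^esub>),
     ring.zero = (\<lambda>i\<in>I. \<zero>\<^bsub>A i\<^esub>),
     ring.add = (\<lambda>u v. \<lambda>i\<in>I. u i \<oplus>\<^bsub>A i\<^esub> v i),
     module.smult = (\<lambda>c u. \<lambda>i\<in>I. c \<odot>\<^bsub>A i\<^esub> u i)\<rparr>"

definition alg_copy :: "('b \<Rightarrow> 'c) \<Rightarrow> ('a, 'b) alg \<Rightarrow> ('a, 'c) alg" where
  \<comment> \<open>The isomorphic copy of an algebra along an injective map \<open>h\<close>. It is used only with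
    \<open>Inl\<close> and \<open>Inr\<close>, in order to put algebras over different element types into one family.\<close>
  "alg_copy h A =
    \<lparr>carrier = h ` carrier A,
     monoid.mult = (\<lambda>u v. h (inv_into UNIV h u \<otimes>\<^bsub>A\<^esub> inv_into UNIV h v)),
     monoid.one = h \<one>\<^bsub>A\<^esub>,
     ring.zero = h \<zero>\<^bsub>A\<^esub>,
     ring.add = (\<lambda>u v. h (inv_into UNIV h u \<oplus>\<^bsub>A\<^esub> inv_into UNIV h v)),
     module.smult = (\<lambda>c u. h (c \<odot>\<^bsub>A\<^esub> inv_into UNIV h u))\<rparr>"

definition group_algebra :: "('g, 'm) monoid_scheme \<Rightarrow> ('a::field, 'g \<Rightarrow> 'a) alg" where
  \<comment> \<open>\<open>u\<close> stands for the formal sum of the \<open>u g \<cdot> g\<close>; the product is the convolution, the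
    coefficient of \<open>g\<close> being the sum of \<open>u h * v (h\<inverse> g)\<close> over the support of \<open>u\<close>\<close>
  "group_algebra G =
    \<lparr>carrier = {u \<in> carrier G \<rightarrow>\<^sub>E UNIV. finite {g \<in> carrier G. u g \<noteq> 0}},
     monoid.mult = (\<lambda>u v. \<lambda>g\<in>carrier G.
       \<Sum>h | h \<in> carrier G \<and> u h \<noteq> 0. u h * v (inv\<^bsub>G\<^esub> h \<otimes>\<^bsub>G\<^esub> g)),
     monoid.one = (\<lambda>g\<in>carrier G. if g = \<one>\<^bsub>G\<^esub> then 1 else 0),
     ring.zero = (\<lambda>g\<in>carrier G. 0),
     ring.add = (\<lambda>u v. \<lambda>g\<in>carrier G. u g + v g),
     module.smult = (\<lambda>c u. \<lambda>g\<in>carrier G. c * u g)\<rparr>"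

definition field_sum2 :: "('a::field, 'a \<times> 'a) alg" where
  "field_sum2 =
    \<lparr>carrier = UNIV,
     monoid.mult = (\<lambda>(a, b) (c, d). (a * c, b * d)),
     monoid.one = (1, 1),
     ring.zero = (0, 0),
     ring.add = (\<lambda>(a, b) (c, d). (a + c, b + d)),
     module.smult = (\<lambda>k (a, b). (k * a, k * b))\<rparr>"

definition field_C2 :: "('a::field, 'a \<times> 'a) alg" where
  \<comment> \<open>The group algebra of the group with two elements, \<open>F[y]/(y\<^sup>2 - 1)\<close>, where \<open>(a, b)\<close> stands for
    \<open>a + b y\<close>. This is the block of \<open>F D\<^sub>2\<^sub>n\<close> on which \<open>x\<close> acts trivially; by the lemma below it splits
    as \<open>F \<oplus> F\<close> only in characteristic other than 2.\<close>
  "field_C2 =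
    \<lparr>carrier = UNIV,
     monoid.mult = (\<lambda>(a, b) (c, d). (a * c + b * d, a * d + b * c)),
     monoid.one = (1, 0),
     ring.zero = (0, 0),
     ring.add = (\<lambda>(a, b) (c, d). (a + c, b + d)),
     module.smult = (\<lambda>k (a, b). (k * a, k * b))\<rparr>"

lemma field_C2_iso_field_sum2_iff:
  "(field_C2 :: ('a::field, 'a \<times> 'a) alg) \<cong>\<^sub>a (field_sum2 :: ('a, 'a \<times> 'a) alg)
    \<longleftrightarrow> CHAR('a) \<noteq> 2"
proof
  assume "(field_C2 :: ('a, 'a \<times> 'a) alg) \<cong>\<^sub>a (field_sum2 :: ('a, 'a \<times> 'a) alg)"
  then obtain h :: "'a \<times> 'a \<Rightarrow> 'a \<times> 'a"
    where h: "h \<in> ring_iso field_C2 field_sum2"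
      and sc: "\<forall>c. \<forall>u\<in>carrier (field_C2 :: ('a, 'a \<times> 'a) alg).
        h (c \<odot>\<^bsub>field_C2\<^esub> u) = c \<odot>\<^bsub>field_sum2\<^esub> h u"
    unfolding alg_iso_def by blast
  have carrier: "u \<in> carrier (field_C2 :: ('a, 'a \<times> 'a) alg)" for u
    by (simp add: field_C2_def)
  have inj: "inj h"
    using h by (simp add: ring_iso_def bij_betw_def field_C2_def)
  have zero: "h (0, 0) = (0, 0)"
    using sc[rule_format, OF carrier, of 0 "(0, 0)"]
    by (simp add: field_C2_def field_sum2_def case_prod_unfold)
  have mult: "h (1 * 1 + 1 * 1, 1 * 1 + 1 * 1) = (fst (h (1, 1)) ^ 2, snd (h (1, 1)) ^ 2)"
    using ring_iso_memE(2)[OF h carrier carrier, of "(1, 1)" "(1, 1)"]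
    by (simp add: field_C2_def field_sum2_def case_prod_unfold power2_eq_square)
  show "CHAR('a) \<noteq> 2"
  proof
    assume "CHAR('a) = 2"
    then have "(1 + 1 :: 'a) = 0"
      using of_nat_CHAR[where ?'a = 'a] by (simp only: of_nat_numeral one_add_one)
    with mult zero have "h (1, 1) = h (0, 0)"
      by (simp add: prod_eq_iff)
    with inj have "(1::'a, 1::'a) = (0, 0)"
      by (rule injD)
    then show False by simp
  qed
next
  assume ch: "CHAR('a) \<noteq> 2"
  have two: "(2::'a) \<noteq> 0"
  proof
    assume "(2::'a) = 0"
    then have "CHAR('a) dvd 2"
      using of_nat_eq_0_iff_char_dvd[of 2, where ?'a = 'a] by simp
    then have "CHAR('a) = 1"
      using ch two_is_prime_nat unfolding prime_nat_iff by blast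
    then show False by simp
  qed
  define h :: "'a \<times> 'a \<Rightarrow> 'a \<times> 'a" where "h = (\<lambda>(a, b). (a + b, a - b))"
  have half: "a / 2 + a / 2 = a" for a :: 'a
    by (simp only: add_divide_distrib[symmetric] mult_2[symmetric] nonzero_mult_div_cancel_left[OF two]
      times_divide_eq_right)
  have inj: "inj h"
  proof (rule injI)
    fix u v assume "h u = h v"
    then have s: "fst u + snd u = fst v + snd v" and d: "fst u - snd u = fst v - snd v"
      by (simp_all add: h_def case_prod_unfold)
    have "2 * fst u = (fst u + snd u) + (fst u - snd u)" by simp
    also have "\<dots> = 2 * fst v" unfolding s d by simp
    finally have "2 * fst u = 2 * fst v" .
    with two have "fst u = fst v" by simp
    with s show "u = v" by (simp add: prod_eq_iff)
  qed
  have surj: "surj h"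
  proof (rule surjI)
    fix w show "h ((fst w + snd w) / 2, (fst w - snd w) / 2) = w"
      using half[of "fst w"] half[of "snd w"]
      by (simp add: h_def prod_eq_iff add_divide_distrib diff_divide_distrib)
  qed
  have "h \<in> ring_iso field_C2 field_sum2"
    using inj surj
    by (simp add: ring_iso_def ring_hom_def field_C2_def field_sum2_def bij_betw_def)
      (simp add: h_def algebra_simps)
  moreover have "h (c \<odot>\<^bsub>field_C2\<^esub> u) = c \<odot>\<^bsub>field_sum2\<^esub> h u" for c u
    by (cases u) (simp add: h_def field_C2_def field_sum2_def algebra_simps)
  ultimately show "(field_C2 :: ('a, 'a \<times> 'a) alg) \<cong>\<^sub>a (field_sum2 :: ('a, 'a \<times> 'a) alg)"
    unfolding alg_iso_def by blast
qed

definition adjoin :: "'a::field alg_closure \<Rightarrow> 'a alg_closure set" where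
  \<comment> \<open>\<open>F[\<beta>]\<close>, as a subring of the algebraic closure of \<open>F\<close>\<close>
  "adjoin \<beta> = range (\<lambda>p::'a poly. poly (map_poly to_ac p) \<beta>)"

definition mat2_alg :: "'a::field alg_closure set \<Rightarrow> ('a, 'a alg_closure^2^2) alg" where
  \<comment> \<open>\<open>M\<^sub>2(K)\<close> for an intermediate ring \<open>K\<close> of the algebraic closure of \<open>F\<close>\<close>
  "mat2_alg K =
    \<lparr>carrier = {M. \<forall>i j. M $ i $ j \<in> K},
     monoid.mult = (**),
     monoid.one = mat 1,
     ring.zero = 0,
     ring.add = (+),
     module.smult = (\<lambda>c M. \<chi> i j. to_ac c * M $ i $ j)\<rparr>"


section \<open>The factorisation of \<open>x^n - 1\<close> and the Wedderburn components\<close>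

definition monic_reciprocal :: "'a::field poly \<Rightarrow> 'a poly" where
  \<comment> \<open>\<open>reflect_poly g\<close> is \<open>x^(deg g) g(1/x)\<close>\<close>
  "monic_reciprocal g = smult (inverse (lead_coeff (reflect_poly g))) (reflect_poly g)"

definition dihedral_factorization ::
    "nat \<Rightarrow> nat \<Rightarrow> nat \<Rightarrow> (nat \<Rightarrow> 'a::field poly) \<Rightarrow> bool" where
  "dihedral_factorization n r s f \<longleftrightarrow>
     (\<forall>j\<in>{1..r+s}. Factorial_Ring.irreducible (f j) \<and> lead_coeff (f j) = 1) \<and>
     [:0, 1:] ^ n - 1 = (\<Prod>j\<in>{1..r}. f j) * (\<Prod>j\<in>{r+1..r+s}. f j * monic_reciprocal (f j)) \<and>
     1 \<le> r \<and> f 1 = [:-1, 1:] \<and> (even n \<longrightarrow> f 2 = [:1, 1:]) \<and>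
     (\<forall>j\<in>{2..r}. monic_reciprocal (f j) = f j) \<and>
     (\<forall>j\<in>{r+1..r+s}. monic_reciprocal (f j) \<noteq> f j)"

definition dihedral_eps :: "'a::field itself \<Rightarrow> nat \<Rightarrow> nat" where
  "dihedral_eps _ n = (if CHAR('a) = 2 then 0 else if odd n then 1 else 2)"

definition dihedral_delta :: "'a::field itself \<Rightarrow> nat \<Rightarrow> nat" where
  "dihedral_delta T n = max (dihedral_eps T n) 1"

definition wedderburn_component ::
    "nat \<Rightarrow> nat \<Rightarrow> (nat \<Rightarrow> 'a::field alg_closure) \<Rightarrow> nat
      \<Rightarrow> ('a, ('a \<times> 'a) + 'a alg_closure^2^2) alg" where
  "wedderburn_component n r \<alpha> j =
     (if j \<le> dihedral_delta TYPE('a) n then alg_copy Inl field_sum2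
      else if j \<le> r then alg_copy Inr (mat2_alg (adjoin (\<alpha> j + inverse (\<alpha> j))))
      else alg_copy Inr (mat2_alg (adjoin (\<alpha> j))))"

end

theory Submission
  imports Defs "HOL-Number_Theory.Residues"
begin

text \<open>
  Every element of the group algebra is \<open>p(x) + q(x) y\<close> with polynomials \<open>p\<close> and \<open>q\<close> of degree less than
  \<open>n\<close>. For an \<open>n\<close>-th root of unity \<open>\<alpha>\<close> in the algebraic closure, \<open>x \<mapsto> diag(\<alpha>, \<alpha>^(-1))\<close> and
  \<open>y \<mapsto> [[0, 1], [1, 0]]\<close> define a representation of the dihedral group over \<open>F[\<alpha>]\<close>, and the image of
  \<open>p(x) + q(x) y\<close> has the four entries \<open>p(\<alpha>)\<close>, \<open>q(\<alpha>)\<close>, \<open>q(\<alpha>^(-1))\<close>, \<open>p(\<alpha>^(-1))\<close>. Each block of the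
  decomposition is a target of this representation for one root of one factor, cut down to its right size:

  \<^item> If the factor is not self-reciprocal, the block is \<open>M\<^sub>2(F[\<alpha>])\<close> as it stands.

  \<^item> If it is self-reciprocal and \<open>\<alpha>^2 \<noteq> 1\<close>, a conjugation turns the image of \<open>x\<close> into the companion
    matrix \<open>[[0, -1], [1, t]]\<close> with \<open>t = \<alpha> + \<alpha>^(-1)\<close> and keeps the image of \<open>y\<close>. The representation is
    thus defined over \<open>F[t]\<close> (\<open>trace_rep_closed\<close>), a field with at most \<open>q^(deg f / 2)\<close> elements
    (\<open>card_adjoin_trace_le\<close>).

  \<^item> If \<open>\<alpha> = \<plusminus>1\<close>, the element \<open>x\<close> acts as a scalar, and the block is the commutative algebra \<open>F \<oplus> F\<close>,
    or \<open>F[y]/(y^2 - 1)\<close> in characteristic 2.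

  In all three cases the image of \<open>p(x) + q(x) y\<close> determines the four values above. The map to the product of
  the blocks is injective: if two elements have the same image, the differences of their polynomials
  vanish at one root of each \<open>f j\<close> and at its inverse, hence at all conjugates of these, hence at
  all \<open>n\<close> roots of \<open>x^n - 1\<close>, which are distinct because \<open>n\<close> is invertible in \<open>F\<close>; having degree less than
  \<open>n\<close>, they are zero (\<open>eq_0_of_conjugates_cover\<close>). It is surjective by counting: the bounds for
  the blocks multiply up to \<open>q^(2 n)\<close> because the degrees of the factors of \<open>x^n - 1\<close> sum to \<open>n\<close>
  (\<open>degree_sum\<close>, \<open>group_algebra_iso_alg_sum\<close>).
\<close>

(* From here on the symbol $ denotes vector components only, not coefficients of power series. *)
no_notation Formal_Power_Series.fps_nth (infixl "$" 75)

section \<open>Polynomials evaluated in the algebraic closure\<close>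

abbreviation aeval :: "'a::field poly \<Rightarrow> 'a alg_closure \<Rightarrow> 'a alg_closure" where
  "aeval p x \<equiv> poly (map_poly to_ac p) x"

lemma map_poly_to_ac_add: "map_poly to_ac (p + q) = map_poly to_ac p + map_poly to_ac q"
  by (intro poly_eqI) (simp add: coeff_map_poly)

lemma map_poly_to_ac_diff: "map_poly to_ac (p - q) = map_poly to_ac p - map_poly to_ac q"
  by (intro poly_eqI) (simp add: coeff_map_poly)

lemma map_poly_to_ac_mult: "map_poly to_ac (p * q) = map_poly to_ac p * map_poly to_ac q"
  by (intro poly_eqI) (simp add: coeff_map_poly coeff_mult to_ac_sum)

lemma map_poly_to_ac_power: "map_poly to_ac (p ^ k) = map_poly to_ac p ^ k"
  by (induction k) (simp_all add: map_poly_to_ac_mult)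

lemma map_poly_to_ac_sum: "map_poly to_ac (sum p A) = (\<Sum>i\<in>A. map_poly to_ac (p i))"
  by (intro poly_eqI) (simp add: coeff_map_poly coeff_sum to_ac_sum)

lemma map_poly_to_ac_prod: "map_poly to_ac (prod p A) = (\<Prod>i\<in>A. map_poly to_ac (p i))"
  by (induction A rule: infinite_finite_induct) (simp_all add: map_poly_to_ac_mult)

lemmas map_poly_to_ac_hom = map_poly_to_ac_add map_poly_to_ac_diff map_poly_to_ac_mult
  map_poly_to_ac_power map_poly_to_ac_sum map_poly_to_ac_prod map_poly_pCons map_poly_monom

lemma map_poly_to_ac_smult: "map_poly to_ac (smult c p) = smult (to_ac c) (map_poly to_ac p)"
  by (simp add: map_poly_smult)

lemma map_poly_to_ac_reflect: "map_poly to_ac (reflect_poly p) = reflect_poly (map_poly to_ac p)"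
  by (intro poly_eqI) (simp add: coeff_map_poly coeff_reflect_poly degree_map_poly)

lemma map_poly_to_ac_root_of_unity:
  "map_poly to_ac ([:0, 1:] ^ n - 1) = [:0, 1:] ^ n - 1"
  by (simp add: map_poly_to_ac_hom)

lemma aeval_reflect_eq_0_iff:
  assumes "x \<noteq> 0"
  shows "aeval (reflect_poly p) x = 0 \<longleftrightarrow> aeval p (inverse x) = 0"
  using assms by (simp add: map_poly_to_ac_reflect poly_reflect_poly_nz)

lemma aeval_monic_reciprocal_eq_0_iff:
  assumes "p \<noteq> 0" and "x \<noteq> 0"
  shows "aeval (monic_reciprocal p) x = 0 \<longleftrightarrow> aeval p (inverse x) = 0"
  using assms
  by (simp add: monic_reciprocal_def map_poly_to_ac_smult aeval_reflect_eq_0_iff)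

lemma degree_monic_reciprocal:
  assumes "coeff p 0 \<noteq> 0"
  shows "degree (monic_reciprocal p) = degree p"
  using assms by (auto simp: monic_reciprocal_def coeff_reflect_poly)

text \<open>
  A nonzero polynomial \<open>g\<close> of least degree vanishing at \<open>x\<close> divides, by division with remainder, every
  polynomial that vanishes at \<open>x\<close>. It divides \<open>f\<close>, hence is associated to \<open>f\<close>.
\<close>

lemma irreducible_dvd_of_common_root:
  fixes f p :: "'a::field poly"
  assumes "Factorial_Ring.irreducible f" "aeval f x = 0" "aeval p x = 0"
  shows "f dvd p"
proof -
  have f0: "f \<noteq> 0" using assms(1) by auto
  define g where "g = arg_min degree (\<lambda>g. g \<noteq> 0 \<and> aeval g x = 0)"
  have g: "g \<noteq> 0" "aeval g x = 0"
    and min: "\<And>h. h \<noteq> 0 \<Longrightarrow> aeval h x = 0 \<Longrightarrow> degree g \<le> degree h"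
    using arg_min_nat_lemma[of "\<lambda>g. g \<noteq> 0 \<and> aeval g x = 0" f degree] f0 assms(2)
    by (auto simp: g_def)
  have gdvd: "g dvd h" if "aeval h x = 0" for h
  proof (rule ccontr)
    assume "\<not> g dvd h"
    then have r: "h mod g \<noteq> 0" by (simp add: dvd_eq_mod_eq_0)
    have "h = (h div g) * g + h mod g" by simp
    then have "aeval h x = aeval (h div g) x * aeval g x + aeval (h mod g) x"
      by (metis map_poly_to_ac_add map_poly_to_ac_mult poly_add poly_mult)
    then have "aeval (h mod g) x = 0" using that g by simp
    then show False using min[OF r] degree_mod_less[of g h] r g(1) by auto
  qed
  have "\<not> g dvd 1"
  proof
    assume "g dvd 1"
    then obtain c where "g = [:c:]" "c \<noteq> 0"
      using g(1) by (auto simp: is_unit_poly_iff)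
    then show False using g(2) by (simp add: map_poly_pCons)
  qed
  moreover obtain k where k: "f = g * k" using gdvd[OF assms(2)] by (elim dvdE)
  ultimately have "k dvd 1" using assms(1) by (auto dest: irreducibleD)
  then have "f dvd g" unfolding k by simp
  also have "g dvd p" by (rule gdvd) fact
  finally show ?thesis .
qed

lemma common_root_transfer:
  assumes "Factorial_Ring.irreducible f" "aeval f x = 0" "aeval p x = 0" "aeval f y = 0"
  shows "aeval p y = 0"
  using irreducible_dvd_of_common_root[OF assms(1-3)] assms(4)
  by (auto simp: map_poly_to_ac_mult elim!: dvdE)

text \<open>
  The derivative \<open>n x^(n-1)\<close> of \<open>x^n - 1\<close> does not vanish at a root of unity, since \<open>n\<close> is nonzero in the
  field.
\<close>

lemma root_of_unity_simple_root:
  fixes a b :: "'k::field poly"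
  assumes "[:0, 1:] ^ n - 1 = a * b" and "(of_nat n :: 'k) \<noteq> 0" and "poly a x = 0"
  shows "poly b x \<noteq> 0"
proof
  assume b: "poly b x = 0"
  have "poly (pderiv ([:0, 1:] ^ n - 1)) x = 0"
    unfolding assms(1) by (simp add: pderiv_mult assms b)
  then have "of_nat n * x ^ (n - 1) = 0"
    by (simp add: pderiv_diff pderiv_power pderiv_pCons)
  then have "x ^ (n - 1) = 0" using assms(2) by simp
  moreover have "poly ([:0, 1:] ^ n - 1) x = 0" unfolding assms(1) by (simp add: b)
  then have "x ^ n = 1" by (simp)
  moreover have "n > 0" using assms(2) by (cases n) auto
  ultimately show False by (cases n) (auto)
qed

lemma degree_X_pow_minus_1: "n > 0 \<Longrightarrow> degree ([:0, 1:] ^ n - 1 :: 'k::field poly) = n"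
  using degree_add_eq_left[of "- 1 :: 'k poly" "[:0, 1:] ^ n"] by (simp add: degree_power_eq)

text \<open>
  Over an algebraically closed field \<open>x^n - 1\<close> is a product of \<open>n\<close> linear factors, and none of
  them is repeated because every root is simple.
\<close>

lemma card_roots_of_unity:
  fixes n :: nat
  assumes n: "(of_nat n :: 'k::alg_closed_field) \<noteq> 0"
  shows "card {x::'k. x ^ n = 1} = n"
proof -
  have n0: "n > 0" using n by (cases n) auto
  let ?P = "[:0, 1:] ^ n - 1 :: 'k poly"
  have P0: "?P \<noteq> 0" using degree_X_pow_minus_1[OF n0, where 'k='k] n0 by auto
  obtain A c where A: "size A = degree ?P" "?P = smult c (\<Prod>x\<in>#A. [:-x, 1:])"
    using alg_closed_imp_factorization[OF P0] by blast
  have c: "c \<noteq> 0" using P0 A(2) by auto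
  have roots: "{x. x ^ n = 1} = set_mset A"
  proof -
    have "x ^ n = 1 \<longleftrightarrow> poly ?P x = 0" for x by simp
    also have "\<dots>x \<longleftrightarrow> x \<in># A" for x
      by (subst A(2), use c in \<open>simp add: poly_prod_mset prod_mset_zero_iff\<close>) auto
    finally show ?thesis by auto
  qed
  have le: "count A x \<le> 1" for x
  proof (rule ccontr)
    assume "\<not> count A x \<le> 1"
    then have "{#x, x#} \<subseteq># A" by (auto simp: subseteq_mset_def)
    then obtain B where B: "A = {#x, x#} + B" by (metis subset_mset.add_diff_inverse)
    have "?P = smult c [:-x, 1:] * ([:-x, 1:] * (\<Prod>x\<in>#B. [:-x, 1:]))"
      unfolding A(2) by (simp only: B image_mset_union prod_mset.union image_mset_add_mset
        image_mset_empty prod_mset.add_mset prod_mset.empty mult_1_right mult_smult_left mult.assoc)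
    from root_of_unity_simple_root[OF this n, of x] show False by simp
  qed
  have "count A x = count (mset_set (set_mset A)) x" for x
  proof (cases "x \<in># A")
    case True
    then have "0 < count A x" by simp
    with le[of x] have "count A x = 1" by linarith
    then show ?thesis using True by simp
  next
    case False
    then show ?thesis by (simp add: not_in_iff)
  qed
  then have "A = mset_set (set_mset A)" by (rule multiset_eqI)
  then have "size A = card (set_mset A)" by (metis size_mset_set)
  then show ?thesis using A(1) degree_X_pow_minus_1[OF n0, where 'k='k] roots by simp
qed

section \<open>Homomorphisms of algebras\<close>

definition alg_hom :: "('a, 'b) alg \<Rightarrow> ('a, 'c) alg \<Rightarrow> ('b \<Rightarrow> 'c) set" where
  "alg_hom A B = {h \<in> ring_hom A B. \<forall>c. \<forall>u\<in>carrier A. h (c \<odot>\<^bsub>A\<^esub> u) = c \<odot>\<^bsub>B\<^esub> h u}"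

lemma alg_homI:
  assumes "\<And>u. u \<in> carrier A \<Longrightarrow> h u \<in> carrier B"
    and "\<And>u v. u \<in> carrier A \<Longrightarrow> v \<in> carrier A \<Longrightarrow> h (u \<otimes>\<^bsub>A\<^esub> v) = h u \<otimes>\<^bsub>B\<^esub> h v"
    and "\<And>u v. u \<in> carrier A \<Longrightarrow> v \<in> carrier A \<Longrightarrow> h (u \<oplus>\<^bsub>A\<^esub> v) = h u \<oplus>\<^bsub>B\<^esub> h v"
    and "h \<one>\<^bsub>A\<^esub> = \<one>\<^bsub>B\<^esub>"
    and "\<And>c u. u \<in> carrier A \<Longrightarrow> h (c \<odot>\<^bsub>A\<^esub> u) = c \<odot>\<^bsub>B\<^esub> h u"
  shows "h \<in> alg_hom A B"
  using assms by (simp add: alg_hom_def ring_hom_def)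

lemma alg_hom_closed: "h \<in> alg_hom A B \<Longrightarrow> u \<in> carrier A \<Longrightarrow> h u \<in> carrier B"
  by (auto simp: alg_hom_def ring_hom_def)

lemma alg_hom_mult:
  "h \<in> alg_hom A B \<Longrightarrow> u \<in> carrier A \<Longrightarrow> v \<in> carrier A \<Longrightarrow> h (u \<otimes>\<^bsub>A\<^esub> v) = h u \<otimes>\<^bsub>B\<^esub> h v"
  by (auto simp: alg_hom_def ring_hom_def)

lemma alg_hom_add:
  "h \<in> alg_hom A B \<Longrightarrow> u \<in> carrier A \<Longrightarrow> v \<in> carrier A \<Longrightarrow> h (u \<oplus>\<^bsub>A\<^esub> v) = h u \<oplus>\<^bsub>B\<^esub> h v"
  by (auto simp: alg_hom_def ring_hom_def)

lemma alg_hom_one: "h \<in> alg_hom A B \<Longrightarrow> h \<one>\<^bsub>A\<^esub> = \<one>\<^bsub>B\<^esub>"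
  by (auto simp: alg_hom_def ring_hom_def)

lemma alg_hom_smult:
  "h \<in> alg_hom A B \<Longrightarrow> u \<in> carrier A \<Longrightarrow> h (c \<odot>\<^bsub>A\<^esub> u) = c \<odot>\<^bsub>B\<^esub> h u"
  by (auto simp: alg_hom_def)

lemma alg_hom_copy:
  assumes e: "inj e" and h: "h \<in> alg_hom A B"
  shows "e \<circ> h \<in> alg_hom A (alg_copy e B)"
proof -
  have inv: "inv_into UNIV e (e x) = x" for x using e by (rule inv_f_f)
  show ?thesis
    by (rule alg_homI)
      (simp_all add: alg_copy_def inv alg_hom_closed[OF h] alg_hom_mult[OF h] alg_hom_add[OF h]
        alg_hom_one[OF h] alg_hom_smult[OF h])
qed

lemma alg_hom_sum:
  assumes h: "\<And>j. j \<in> I \<Longrightarrow> h j \<in> alg_hom A (B j)"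
  shows "(\<lambda>u. \<lambda>j\<in>I. h j u) \<in> alg_hom A (alg_sum I B)"
proof (rule alg_homI)
  fix u v assume u: "u \<in> carrier A" and v: "v \<in> carrier A"
  show "(\<lambda>j\<in>I. h j (u \<otimes>\<^bsub>A\<^esub> v)) = (\<lambda>j\<in>I. h j u) \<otimes>\<^bsub>alg_sum I B\<^esub> (\<lambda>j\<in>I. h j v)"
    using alg_hom_mult[OF h u v] by (simp add: alg_sum_def cong: restrict_cong)
  show "(\<lambda>j\<in>I. h j (u \<oplus>\<^bsub>A\<^esub> v)) = (\<lambda>j\<in>I. h j u) \<oplus>\<^bsub>alg_sum I B\<^esub> (\<lambda>j\<in>I. h j v)"
    using alg_hom_add[OF h u v] by (simp add: alg_sum_def cong: restrict_cong)
next
  fix u c assume u: "u \<in> carrier A"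
  show "(\<lambda>j\<in>I. h j u) \<in> carrier (alg_sum I B)"
    using alg_hom_closed[OF h u] by (simp add: alg_sum_def)
  show "(\<lambda>j\<in>I. h j (c \<odot>\<^bsub>A\<^esub> u)) = c \<odot>\<^bsub>alg_sum I B\<^esub> (\<lambda>j\<in>I. h j u)"
    using alg_hom_smult[OF h u] by (simp add: alg_sum_def cong: restrict_cong)
next
  show "(\<lambda>j\<in>I. h j \<one>\<^bsub>A\<^esub>) = \<one>\<^bsub>alg_sum I B\<^esub>"
    using alg_hom_one[OF h] by (simp add: alg_sum_def cong: restrict_cong)
qed

text \<open>
  In place of an explicit preimage: an injective map into a finite set that is no larger than its
  source is onto.
\<close>

lemma alg_iso_of_card_le:
  assumes h: "h \<in> alg_hom A B" and inj: "inj_on h (carrier A)"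
    and fin: "finite (carrier B)" and card: "card (carrier B) \<le> card (carrier A)"
  shows "A \<cong>\<^sub>a B"
proof -
  have "h ` carrier A \<subseteq> carrier B" using h by (auto dest: alg_hom_closed)
  moreover have "card (h ` carrier A) = card (carrier A)" using inj by (rule card_image)
  ultimately have "h ` carrier A = carrier B"
    using fin card by (metis card_seteq)
  then have "h \<in> ring_iso A B"
    using h inj by (auto simp: ring_iso_def bij_betw_def alg_hom_def)
  then show ?thesis using h by (auto simp: alg_iso_def alg_hom_def)
qed

section \<open>Linear extension of functions on a group to its group algebra\<close>

text \<open>
  Blocks take values in \<open>F\<close> itself or in its algebraic closure; this locale treats both embeddings of
  the scalars at once.
\<close>

locale scalar_hom =
  fixes \<iota> :: "'a::field \<Rightarrow> 'b::comm_ring_1"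
  assumes scalar_add: "\<iota> (a + b) = \<iota> a + \<iota> b"
    and scalar_mult: "\<iota> (a * b) = \<iota> a * \<iota> b"
    and scalar_1: "\<iota> 1 = 1"
begin

lemma scalar_0: "\<iota> 0 = 0"
  using scalar_add[of 0 0] by simp

lemma scalar_sum: "\<iota> (sum a A) = (\<Sum>x\<in>A. \<iota> (a x))"
  by (induction A rule: infinite_finite_induct) (simp_all add: scalar_add scalar_0)

end

interpretation scalar_id: scalar_hom "\<lambda>a. a"
  by (rule scalar_hom.intro) simp_all

interpretation scalar_to_ac: scalar_hom to_ac
  by (rule scalar_hom.intro) simp_all

text \<open>
  The linear extension of a function on the group to the group algebra. Every block map below is
  a tuple of such extensions.
\<close>

definition pairing ::
    "('g, 'm) monoid_scheme \<Rightarrow> ('a \<Rightarrow> 'b::comm_ring_1) \<Rightarrow> ('g \<Rightarrow> 'a) \<Rightarrow> ('g \<Rightarrow> 'b) \<Rightarrow> 'b" where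
  "pairing G \<iota> u \<phi> = (\<Sum>g\<in>carrier G. \<iota> (u g) * \<phi> g)"

context scalar_hom
begin

lemma pairing_add:
  "pairing G \<iota> (u \<oplus>\<^bsub>group_algebra G\<^esub> v) \<phi> = pairing G \<iota> u \<phi> + pairing G \<iota> v \<phi>"
  unfolding pairing_def sum.distrib[symmetric]
  by (intro sum.cong refl) (simp add: group_algebra_def scalar_add distrib_right)

lemma pairing_smult: "pairing G \<iota> (c \<odot>\<^bsub>group_algebra G\<^esub> u) \<phi> = \<iota> c * pairing G \<iota> u \<phi>"
  unfolding pairing_def sum_distrib_left
  by (intro sum.cong refl) (simp add: group_algebra_def scalar_mult mult.assoc)

lemma pairing_one:
  assumes "group G" and "finite (carrier G)"
  shows "pairing G \<iota> \<one>\<^bsub>group_algebra G\<^esub> \<phi> = \<phi> \<one>\<^bsub>G\<^esub>"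
proof -
  interpret group G by fact
  have "pairing G \<iota> \<one>\<^bsub>group_algebra G\<^esub> \<phi> = (\<Sum>g\<in>carrier G. if g = \<one>\<^bsub>G\<^esub> then \<phi> g else 0)"
    unfolding pairing_def by (intro sum.cong) (auto simp: group_algebra_def scalar_0 scalar_1)
  then show ?thesis using assms(2) by simp
qed

lemma pairing_mult:
  assumes "group G" and fin: "finite (carrier G)"
  shows "pairing G \<iota> (u \<otimes>\<^bsub>group_algebra G\<^esub> v) \<phi> =
    (\<Sum>h\<in>carrier G. \<Sum>k\<in>carrier G. \<iota> (u h) * \<iota> (v k) * \<phi> (h \<otimes>\<^bsub>G\<^esub> k))"
proof -
  interpret group G by fact
  have conv: "(u \<otimes>\<^bsub>group_algebra G\<^esub> v) g = (\<Sum>h\<in>carrier G. u h * v (inv\<^bsub>G\<^esub> h \<otimes>\<^bsub>G\<^esub> g))"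
    if "g \<in> carrier G" for g
  proof -
    have "(\<Sum>h | h \<in> carrier G \<and> u h \<noteq> 0. u h * v (inv\<^bsub>G\<^esub> h \<otimes>\<^bsub>G\<^esub> g)) =
        (\<Sum>h\<in>carrier G. u h * v (inv\<^bsub>G\<^esub> h \<otimes>\<^bsub>G\<^esub> g))"
      by (rule sum.mono_neutral_left) (use fin in auto)
    then show ?thesis using that by (simp add: group_algebra_def)
  qed
  have "pairing G \<iota> (u \<otimes>\<^bsub>group_algebra G\<^esub> v) \<phi> =
      (\<Sum>g\<in>carrier G. \<Sum>h\<in>carrier G. \<iota> (u h) * \<iota> (v (inv\<^bsub>G\<^esub> h \<otimes>\<^bsub>G\<^esub> g)) * \<phi> g)"
    unfolding pairing_def
    by (intro sum.cong) (simp_all add: conv scalar_sum scalar_mult sum_distrib_right)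
  also have "\<dots> = (\<Sum>h\<in>carrier G. \<Sum>g\<in>carrier G. \<iota> (u h) * \<iota> (v (inv\<^bsub>G\<^esub> h \<otimes>\<^bsub>G\<^esub> g)) * \<phi> g)"
    by (rule sum.swap)
  also have "\<dots> = (\<Sum>h\<in>carrier G. \<Sum>k\<in>carrier G. \<iota> (u h) * \<iota> (v k) * \<phi> (h \<otimes>\<^bsub>G\<^esub> k))"
  proof (rule sum.cong[OF refl])
    fix h assume h: "h \<in> carrier G"
    have inv: "h \<otimes>\<^bsub>G\<^esub> (inv\<^bsub>G\<^esub> h \<otimes>\<^bsub>G\<^esub> g) = g" "inv\<^bsub>G\<^esub> h \<otimes>\<^bsub>G\<^esub> (h \<otimes>\<^bsub>G\<^esub> g) = g"
      if "g \<in> carrier G" for g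
      using h that by (metis m_assoc inv_closed r_inv l_inv l_one)+
    show "(\<Sum>g\<in>carrier G. \<iota> (u h) * \<iota> (v (inv\<^bsub>G\<^esub> h \<otimes>\<^bsub>G\<^esub> g)) * \<phi> g) =
        (\<Sum>k\<in>carrier G. \<iota> (u h) * \<iota> (v k) * \<phi> (h \<otimes>\<^bsub>G\<^esub> k))"
      by (rule sum.reindex_bij_witness[of _ "\<lambda>k. h \<otimes>\<^bsub>G\<^esub> k" "\<lambda>g. inv\<^bsub>G\<^esub> h \<otimes>\<^bsub>G\<^esub> g"])
        (simp_all add: inv h)
  qed
  finally show ?thesis .
qed

text \<open>
  This makes linear extensions multiplicative. It applies to characters (one summand), to entries of
  matrix representations (the sum of the matrix product), and to the indicator functions of the fibres of
  a homomorphism to a group with two elements.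
\<close>

lemma pairing_mult_decomp:
  assumes "group G" and "finite (carrier G)"
    and "\<And>h k. h \<in> carrier G \<Longrightarrow> k \<in> carrier G \<Longrightarrow> \<phi> (h \<otimes>\<^bsub>G\<^esub> k) = (\<Sum>l\<in>L. \<psi> l h * \<theta> l k)"
  shows "pairing G \<iota> (u \<otimes>\<^bsub>group_algebra G\<^esub> v) \<phi> =
    (\<Sum>l\<in>L. pairing G \<iota> u (\<psi> l) * pairing G \<iota> v (\<theta> l))"
proof -
  have "pairing G \<iota> (u \<otimes>\<^bsub>group_algebra G\<^esub> v) \<phi> =
      (\<Sum>h\<in>carrier G. \<Sum>k\<in>carrier G. \<Sum>l\<in>L. (\<iota> (u h) * \<psi> l h) * (\<iota> (v k) * \<theta> l k))"
    unfolding pairing_mult[OF assms(1,2)]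
    by (intro sum.cong refl) (simp add: assms(3) sum_distrib_left algebra_simps)
  also have "\<dots> = (\<Sum>l\<in>L. \<Sum>h\<in>carrier G. \<Sum>k\<in>carrier G. (\<iota> (u h) * \<psi> l h) * (\<iota> (v k) * \<theta> l k))"
    (is "_ = ?r")
  proof -
    have "?r = (\<Sum>h\<in>carrier G. \<Sum>l\<in>L. \<Sum>k\<in>carrier G. (\<iota> (u h) * \<psi> l h) * (\<iota> (v k) * \<theta> l k))"
      by (rule sum.swap)
    also have "\<dots> = (\<Sum>h\<in>carrier G. \<Sum>k\<in>carrier G. \<Sum>l\<in>L. (\<iota> (u h) * \<psi> l h) * (\<iota> (v k) * \<theta> l k))"
      by (intro sum.cong refl) (rule sum.swap)
    finally show ?thesis by (rule sym)
  qed
  finally show ?thesis by (simp add: pairing_def sum_product)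
qed

end

definition extend_rep ::
    "('g, 'm) monoid_scheme \<Rightarrow> ('g \<Rightarrow> 'a::field alg_closure^2^2) \<Rightarrow> ('g \<Rightarrow> 'a) \<Rightarrow> 'a alg_closure^2^2"
  where "extend_rep G \<rho> u = (\<chi> i k. pairing G to_ac u (\<lambda>g. \<rho> g $ i $ k))"

lemma adjoinI: "aeval p \<beta> \<in> adjoin \<beta>"
  unfolding adjoin_def by (rule rangeI)

lemma adjoinE:
  assumes "x \<in> adjoin \<beta>" obtains p where "x = aeval p \<beta>"
  using assms unfolding adjoin_def by blast

lemma adjoin_mult_closed:
  assumes "x \<in> adjoin \<beta>" "y \<in> adjoin \<beta>" shows "x * y \<in> adjoin \<beta>"
proof -
  obtain p q where "x = aeval p \<beta>" "y = aeval q \<beta>" using assms by (metis adjoinE)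
  then have "x * y = aeval (p * q) \<beta>" by (simp add: map_poly_to_ac_mult)
  then show ?thesis using adjoinI by metis
qed

lemma adjoin_add_closed:
  assumes "x \<in> adjoin \<beta>" "y \<in> adjoin \<beta>" shows "x + y \<in> adjoin \<beta>"
proof -
  obtain p q where "x = aeval p \<beta>" "y = aeval q \<beta>" using assms by (metis adjoinE)
  then have "x + y = aeval (p + q) \<beta>" by (simp add: map_poly_to_ac_add)
  then show ?thesis using adjoinI by metis
qed

lemma to_ac_in_adjoin [simp]: "to_ac c \<in> adjoin \<beta>"
  using adjoinI[of "[:c:]" \<beta>] by (simp add: map_poly_pCons)

lemma zero_in_adjoin [simp]: "0 \<in> adjoin \<beta>" and one_in_adjoin [simp]: "1 \<in> adjoin \<beta>"
  and minus_one_in_adjoin [simp]: "-1 \<in> adjoin \<beta>"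
  using to_ac_in_adjoin[of 0 \<beta>] to_ac_in_adjoin[of 1 \<beta>] to_ac_in_adjoin[of "-1" \<beta>]
  by (simp_all del: to_ac_in_adjoin)

lemma adjoin_self [simp]: "\<beta> \<in> adjoin \<beta>"
  using adjoinI[of "[:0, 1:]" \<beta>] by (simp add: map_poly_pCons)

lemma adjoin_sum_closed: "(\<And>x. x \<in> A \<Longrightarrow> c x \<in> adjoin \<beta>) \<Longrightarrow> sum c A \<in> adjoin \<beta>"
  by (induction A rule: infinite_finite_induct) (simp_all add: adjoin_add_closed)

lemma mat2_alg_mult_closed:
  assumes "M \<in> carrier (mat2_alg (adjoin \<beta>))" "N \<in> carrier (mat2_alg (adjoin \<beta>))"
  shows "M ** N \<in> carrier (mat2_alg (adjoin \<beta>))"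
  using assms
  by (auto simp: mat2_alg_def matrix_matrix_mult_def intro!: adjoin_sum_closed adjoin_mult_closed)

lemma extend_rep_alg_hom:
  assumes G: "group G" "finite (carrier G)"
    and closed: "\<And>g. g \<in> carrier G \<Longrightarrow> \<rho> g \<in> carrier (mat2_alg (adjoin \<beta>))"
    and mult: "\<And>g h. g \<in> carrier G \<Longrightarrow> h \<in> carrier G \<Longrightarrow> \<rho> (g \<otimes>\<^bsub>G\<^esub> h) = \<rho> g ** \<rho> h"
    and one: "\<rho> \<one>\<^bsub>G\<^esub> = mat 1"
  shows "extend_rep G \<rho> \<in> alg_hom (group_algebra G) (mat2_alg (adjoin \<beta>))"
proof (rule alg_homI)
  fix u show "extend_rep G \<rho> u \<in> carrier (mat2_alg (adjoin \<beta>))"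
    using closed
    by (auto simp: mat2_alg_def extend_rep_def pairing_def intro!: adjoin_sum_closed adjoin_mult_closed)
next
  fix u v
  show "extend_rep G \<rho> (u \<otimes>\<^bsub>group_algebra G\<^esub> v) =
      extend_rep G \<rho> u \<otimes>\<^bsub>mat2_alg (adjoin \<beta>)\<^esub> extend_rep G \<rho> v"
    unfolding vec_eq_iff
  proof (intro allI)
    fix i k
    have "pairing G to_ac (u \<otimes>\<^bsub>group_algebra G\<^esub> v) (\<lambda>g. \<rho> g $ i $ k) =
        (\<Sum>l\<in>UNIV. pairing G to_ac u (\<lambda>g. \<rho> g $ i $ l) * pairing G to_ac v (\<lambda>g. \<rho> g $ l $ k))"
      by (rule scalar_to_ac.pairing_mult_decomp[OF G]) (simp add: mult matrix_matrix_mult_def)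
    then show "extend_rep G \<rho> (u \<otimes>\<^bsub>group_algebra G\<^esub> v) $ i $ k =
        (extend_rep G \<rho> u \<otimes>\<^bsub>mat2_alg (adjoin \<beta>)\<^esub> extend_rep G \<rho> v) $ i $ k"
      by (simp add: extend_rep_def mat2_alg_def matrix_matrix_mult_def)
  qed
next
  fix u v
  show "extend_rep G \<rho> (u \<oplus>\<^bsub>group_algebra G\<^esub> v) =
      extend_rep G \<rho> u \<oplus>\<^bsub>mat2_alg (adjoin \<beta>)\<^esub> extend_rep G \<rho> v"
    by (simp add: vec_eq_iff extend_rep_def mat2_alg_def scalar_to_ac.pairing_add)
next
  show "extend_rep G \<rho> \<one>\<^bsub>group_algebra G\<^esub> = \<one>\<^bsub>mat2_alg (adjoin \<beta>)\<^esub>"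
    by (simp add: vec_eq_iff extend_rep_def mat2_alg_def scalar_to_ac.pairing_one[OF G] one)
next
  fix c u
  show "extend_rep G \<rho> (c \<odot>\<^bsub>group_algebra G\<^esub> u) = c \<odot>\<^bsub>mat2_alg (adjoin \<beta>)\<^esub> extend_rep G \<rho> u"
    by (simp add: vec_eq_iff extend_rep_def mat2_alg_def scalar_to_ac.pairing_smult)
qed

lemma extend_rep_mult_left: "extend_rep G (\<lambda>g. P ** \<rho> g) u = P ** extend_rep G \<rho> u"
proof -
  have "to_ac (u g) * (\<Sum>l\<in>UNIV. P $ i $ l * \<rho> g $ l $ k) =
      (\<Sum>l\<in>UNIV. P $ i $ l * (to_ac (u g) * \<rho> g $ l $ k))" for g and i k :: 2
    by (simp add: sum_distrib_left mult.left_commute)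
  then show ?thesis
    by (simp add: vec_eq_iff extend_rep_def pairing_def matrix_matrix_mult_def sum_distrib_left)
      (simp add: sum.swap[of _ _ "carrier G"])
qed

lemma extend_rep_mult_right: "extend_rep G (\<lambda>g. \<rho> g ** Q) u = extend_rep G \<rho> u ** Q"
proof -
  have "to_ac (u g) * (\<Sum>l\<in>UNIV. \<rho> g $ i $ l * Q $ l $ k) =
      (\<Sum>l\<in>UNIV. (to_ac (u g) * \<rho> g $ i $ l) * Q $ l $ k)" for g and i k :: 2
    by (simp add: sum_distrib_left mult.assoc)
  then show ?thesis
    by (simp add: vec_eq_iff extend_rep_def pairing_def matrix_matrix_mult_def sum_distrib_right)
      (simp add: sum.swap[of _ _ "carrier G"])
qed

text \<open>
  For mutually inverse \<open>P\<close> and \<open>Q\<close>, this shows that conjugate representations have extensions with the same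
  kernel.
\<close>

lemma extend_rep_conjugate:
  "extend_rep G (\<lambda>g. P ** \<rho> g ** Q) u = P ** extend_rep G \<rho> u ** Q"
  by (simp only: extend_rep_mult_right extend_rep_mult_left)

lemma character_pair_alg_hom:
  fixes \<phi> \<psi> :: "'g \<Rightarrow> 'a::field"
  assumes G: "group G" "finite (carrier G)"
    and "\<And>g h. g \<in> carrier G \<Longrightarrow> h \<in> carrier G \<Longrightarrow> \<phi> (g \<otimes>\<^bsub>G\<^esub> h) = \<phi> g * \<phi> h"
    and "\<And>g h. g \<in> carrier G \<Longrightarrow> h \<in> carrier G \<Longrightarrow> \<psi> (g \<otimes>\<^bsub>G\<^esub> h) = \<psi> g * \<psi> h"
    and "\<phi> \<one>\<^bsub>G\<^esub> = 1" "\<psi> \<one>\<^bsub>G\<^esub> = 1"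
  shows "(\<lambda>u. (pairing G (\<lambda>a. a) u \<phi>, pairing G (\<lambda>a. a) u \<psi>)) \<in> alg_hom (group_algebra G) field_sum2"
proof -
  have "pairing G (\<lambda>a. a) (u \<otimes>\<^bsub>group_algebra G\<^esub> v) \<phi> =
      pairing G (\<lambda>a. a) u \<phi> * pairing G (\<lambda>a. a) v \<phi>" for u v
    using scalar_id.pairing_mult_decomp[OF G, where \<phi> = \<phi> and L = "{()}" and \<psi> = "\<lambda>_. \<phi>"
        and \<theta> = "\<lambda>_. \<phi>"] assms(3) by simp
  moreover have "pairing G (\<lambda>a. a) (u \<otimes>\<^bsub>group_algebra G\<^esub> v) \<psi> =
      pairing G (\<lambda>a. a) u \<psi> * pairing G (\<lambda>a. a) v \<psi>" for u v
    using scalar_id.pairing_mult_decomp[OF G, where \<phi> = \<psi> and L = "{()}" and \<psi> = "\<lambda>_. \<psi>"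
        and \<theta> = "\<lambda>_. \<psi>"] assms(4) by simp
  ultimately show ?thesis
    using assms(5,6)
    by (intro alg_homI) (simp_all add: scalar_id.pairing_add scalar_id.pairing_smult
        scalar_id.pairing_one[OF G], simp_all add: field_sum2_def)
qed

text \<open>
  A homomorphism to a group with two elements induces a map of group algebras to
  \<open>F[y]/(y^2 - 1)\<close>, whose coordinates sum the coefficients over the two fibres.
\<close>

lemma parity_pair_alg_hom:
  fixes G :: "('g, 'm) monoid_scheme" and \<epsilon> :: "'g \<Rightarrow> bool"
  assumes G: "group G" "finite (carrier G)"
    and hom: "\<And>g h. g \<in> carrier G \<Longrightarrow> h \<in> carrier G \<Longrightarrow> \<epsilon> (g \<otimes>\<^bsub>G\<^esub> h) \<longleftrightarrow> \<epsilon> g \<noteq> \<epsilon> h"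
    and one: "\<not> \<epsilon> \<one>\<^bsub>G\<^esub>"
  defines "\<phi> \<equiv> \<lambda>b g. if \<epsilon> g = b then 1 else 0 :: 'a::field"
  shows "(\<lambda>u. (pairing G (\<lambda>a. a) u (\<phi> False), pairing G (\<lambda>a. a) u (\<phi> True)))
    \<in> alg_hom (group_algebra G) field_C2"
proof -
  have "pairing G (\<lambda>a. a) (u \<otimes>\<^bsub>group_algebra G\<^esub> v) (\<phi> b) =
      (\<Sum>c\<in>UNIV. pairing G (\<lambda>a. a) u (\<phi> c) * pairing G (\<lambda>a. a) v (\<phi> (c \<noteq> b)))" for u v b
    by (rule scalar_id.pairing_mult_decomp[OF G]) (auto simp: \<phi>_def hom UNIV_bool)
  then show ?thesis
    using one
    by (intro alg_homI) (simp_all add: scalar_id.pairing_add scalar_id.pairing_smult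
        scalar_id.pairing_one[OF G] UNIV_bool, simp_all add: field_C2_def \<phi>_def)
qed

section \<open>Cardinalities of the coefficient rings and of their matrix algebras\<close>

lemma map_poly_to_ac_pcompose:
  "map_poly to_ac (pcompose p q) = pcompose (map_poly to_ac p) (map_poly to_ac q)"
  by (induction p) (simp_all add: pcompose_pCons map_poly_to_ac_hom)

text \<open>
  Reducing modulo \<open>f\<close>, every element of \<open>F[\<alpha>]\<close> is a combination of \<open>1, \<alpha>, \<dots>, \<alpha>^(deg f - 1)\<close>.
\<close>

lemma card_adjoin_le:
  fixes f :: "'a::{field, finite} poly"
  assumes f: "f \<noteq> 0" and root: "aeval f \<alpha> = 0"
  shows "finite (adjoin \<alpha>)" and "card (adjoin \<alpha>) \<le> CARD('a) ^ degree f"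
proof -
  define F where "F = (\<lambda>c::nat \<Rightarrow> 'a. \<Sum>i<degree f. to_ac (c i) * \<alpha> ^ i)"
  define C where "C = ({..<degree f} \<rightarrow>\<^sub>E (UNIV :: 'a set))"
  have d: "degree f > 0"
  proof (rule ccontr)
    assume "\<not> degree f > 0"
    then obtain c where "f = [:c:]" by (auto elim: degree_eq_zeroE)
    then show False using f root by (simp add: map_poly_pCons)
  qed
  have sub: "adjoin \<alpha> \<subseteq> F ` C"
  proof
    fix x assume "x \<in> adjoin \<alpha>"
    then obtain p where p: "x = aeval p \<alpha>" by (rule adjoinE)
    define r where "r = p mod f"
    have r: "degree r < degree f"
      using degree_mod_less[OF f, of p] d by (auto simp: r_def)
    have "p = (p div f) * f + r" by (simp add: r_def)
    then have "aeval p \<alpha> = aeval (p div f) \<alpha> * aeval f \<alpha> + aeval r \<alpha>"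
      by (metis map_poly_to_ac_add map_poly_to_ac_mult poly_add poly_mult)
    then have "x = aeval r \<alpha>" using p root by simp
    also have "\<dots> = (\<Sum>i\<le>degree r. to_ac (coeff r i) * \<alpha> ^ i)"
      by (simp add: poly_altdef degree_map_poly coeff_map_poly)
    also have "\<dots> = (\<Sum>i<degree f. to_ac (coeff r i) * \<alpha> ^ i)"
      by (rule sum.mono_neutral_left) (use r in \<open>auto simp: coeff_eq_0\<close>)
    also have "\<dots> = F (restrict (coeff r) {..<degree f})" by (simp add: F_def)
    finally show "x \<in> F ` C" by (auto simp: C_def)
  qed
  have fin: "finite C" by (simp add: C_def finite_PiE)
  show "finite (adjoin \<alpha>)" using sub fin by (meson finite_imageI finite_subset)
  have "card (adjoin \<alpha>) \<le> card (F ` C)" using sub fin by (intro card_mono) auto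
  also have "\<dots> \<le> card C" using fin by (rule card_image_le)
  also have "\<dots> = CARD('a) ^ degree f" by (simp add: C_def card_PiE)
  finally show "card (adjoin \<alpha>) \<le> CARD('a) ^ degree f" .
qed

text \<open>
  \<open>F[\<alpha>]\<close> is at least quadratic over \<open>F[t]\<close>: the map \<open>(u, v) \<mapsto> u + v \<alpha>\<close> on \<open>F[t] \<times> F[t]\<close> is injective.
  Indeed, a relation between its values is a polynomial relation satisfied by \<open>\<alpha>\<close>, hence
  also by the conjugate \<open>\<alpha>^(-1)\<close>. Conjugation fixes \<open>F[t]\<close> and moves \<open>\<alpha>\<close>, so subtracting the two relations
  gives \<open>v = v'\<close>.
\<close>

lemma card_adjoin_trace_le:
  fixes f :: "'a::{field, finite} poly"
  assumes f: "Factorial_Ring.irreducible f" and root: "aeval f \<alpha> = 0" "aeval f (inverse \<alpha>) = 0"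
    and n: "n > 0" "\<alpha> ^ n = 1" and ne: "\<alpha> \<noteq> inverse \<alpha>"
  defines "t \<equiv> \<alpha> + inverse \<alpha>"
  shows "finite (adjoin t)" and "card (adjoin t) ^ 2 \<le> CARD('a) ^ degree f"
proof -
  have f0: "f \<noteq> 0" using f by auto
  have inv: "inverse \<alpha> = \<alpha> ^ (n - 1)" "\<alpha> = inverse \<alpha> ^ (n - 1)"
  proof -
    have "x ^ (n - 1) = inverse x" if "x ^ n = 1" for x :: "'a alg_closure"
      using that n(1) by (intro inverse_unique[symmetric]) (simp add: power_eq_if)
    from this[of \<alpha>] this[of "inverse \<alpha>"] n(2)
    show "inverse \<alpha> = \<alpha> ^ (n - 1)" "\<alpha> = inverse \<alpha> ^ (n - 1)"
      by (simp_all add: power_inverse)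
  qed
  \<comment> \<open>\<open>\<tau>\<close> takes the value \<open>t\<close> at both \<open>\<alpha>\<close> and \<open>\<alpha>^(-1)\<close>, so \<open>p \<circ> \<tau>\<close> turns a polynomial in \<open>t\<close> into one in \<open>\<alpha>\<close>\<close>
  define \<tau> :: "'a poly" where "\<tau> = [:0, 1:] + [:0, 1:] ^ (n - 1)"
  define T where "T = (\<lambda>p::'a poly. pcompose p \<tau>)"
  have T: "aeval (T p) \<alpha> = aeval p t" "aeval (T p) (inverse \<alpha>) = aeval p t" for p
    using inv by (simp_all add: T_def \<tau>_def t_def map_poly_to_ac_pcompose map_poly_to_ac_hom poly_pcompose
        add.commute)
  have sub: "adjoin t \<subseteq> adjoin \<alpha>"
    using T(1) by (metis adjoinE adjoinI subsetI)
  show fin: "finite (adjoin t)" using sub card_adjoin_le(1)[OF f0 root(1)] by (rule finite_subset)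
  define \<Theta> where "\<Theta> = (\<lambda>(u, v). u + v * \<alpha>)"
  have "inj_on \<Theta> (adjoin t \<times> adjoin t)"
  proof (rule inj_onI)
    fix x y assume x: "x \<in> adjoin t \<times> adjoin t" and y: "y \<in> adjoin t \<times> adjoin t" and eq: "\<Theta> x = \<Theta> y"
    obtain a b where ab: "x = (aeval a t, aeval b t)" using x by (auto elim!: adjoinE)
    obtain c d where cd: "y = (aeval c t, aeval d t)" using y by (auto elim!: adjoinE)
    define p where "p = (T a - T c) + (T b - T d) * [:0, 1:]"
    have val: "aeval p z = (aeval a t - aeval c t) + (aeval b t - aeval d t) * z"
      if "z = \<alpha> \<or> z = inverse \<alpha>" for z
      using that by (auto simp: p_def map_poly_to_ac_hom T)
    have 1: "aeval p \<alpha> = 0"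
      using eq by (simp add: val) (simp add: ab cd \<Theta>_def algebra_simps)
    have 2: "aeval p (inverse \<alpha>) = 0"
      by (rule common_root_transfer[OF f root(1) 1 root(2)])
    have "(aeval b t - aeval d t) * (\<alpha> - inverse \<alpha>) = aeval p \<alpha> - aeval p (inverse \<alpha>)"
      by (simp add: val) (simp add: algebra_simps)
    then have "aeval b t = aeval d t" using 1 2 ne by simp
    moreover from this have "aeval a t = aeval c t" using 1 by (simp add: val)
    ultimately show "x = y" by (simp add: ab cd)
  qed
  moreover have "\<Theta> ` (adjoin t \<times> adjoin t) \<subseteq> adjoin \<alpha>"
  proof clarify
    fix u v assume "u \<in> adjoin t" "v \<in> adjoin t"
    with sub have "u \<in> adjoin \<alpha>" "v \<in> adjoin \<alpha>" by blast+
    then show "\<Theta> (u, v) \<in> adjoin \<alpha>"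
      by (simp add: \<Theta>_def adjoin_add_closed adjoin_mult_closed)
  qed
  ultimately have "card (adjoin t \<times> adjoin t) \<le> card (adjoin \<alpha>)"
    using card_adjoin_le(1)[OF f0 root(1)] by (rule card_inj_on_le)
  also have "\<dots> \<le> CARD('a) ^ degree f" by (rule card_adjoin_le(2)[OF f0 root(1)])
  finally show "card (adjoin t) ^ 2 \<le> CARD('a) ^ degree f"
    by (simp add: card_cartesian_product power2_eq_square)
qed

lemma card_mat2_alg_le:
  assumes "finite K"
  shows "finite (carrier (mat2_alg K))" and "card (carrier (mat2_alg K)) \<le> card K ^ 4"
proof -
  define e :: "'a alg_closure^2^2 \<Rightarrow> _" where "e = (\<lambda>M. ((M $ 1 $ 1, M $ 1 $ 2), (M $ 2 $ 1, M $ 2 $ 2)))"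
  have inj: "inj_on e (carrier (mat2_alg K))"
    by (rule inj_onI) (auto simp: e_def vec_eq_iff forall_2)
  have sub: "e ` carrier (mat2_alg K) \<subseteq> (K \<times> K) \<times> (K \<times> K)"
    by (auto simp: e_def mat2_alg_def)
  have fin: "finite ((K \<times> K) \<times> (K \<times> K))" using assms by simp
  show "finite (carrier (mat2_alg K))" using inj sub fin by (meson finite_imageD finite_subset)
  have "card (carrier (mat2_alg K)) \<le> card ((K \<times> K) \<times> (K \<times> K))"
    by (rule card_inj_on_le[OF inj sub fin])
  then show "card (carrier (mat2_alg K)) \<le> card K ^ 4"
    by (simp add: card_cartesian_product power4_eq_xxxx mult.assoc)
qed

section \<open>Representations of the dihedral group\<close>

lemma finite_dihedral_group: "finite (carrier (dihedral_group n))"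
  by (simp add: dihedral_group_def)

lemma dihedral_carrierE:
  assumes "g \<in> carrier (dihedral_group n)"
  obtains i where "g = (int i, snd g)" and "i < n"
  using assms that[of "nat (fst g)"] by (auto simp: dihedral_group_def)

text \<open>
  The representation \<open>x \<mapsto> diag(\<alpha>, \<alpha>^(-1))\<close>, \<open>y \<mapsto>\<close> the permutation matrix of the transposition.
\<close>

definition dihedral_rep :: "'k::field \<Rightarrow> int \<times> bool \<Rightarrow> 'k^2^2" where
  "dihedral_rep \<alpha> g =
    (\<chi> r c. if (r = c) = snd g then 0 else if r = 1 then \<alpha> powi fst g else inverse \<alpha> powi fst g)"

lemma power_int_mod_eq:
  fixes \<alpha> :: "'k::field"
  assumes "\<alpha> ^ n = 1" and "n > 0"
  shows "\<alpha> powi (i mod int n) = \<alpha> powi i"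
proof -
  have a0: "\<alpha> \<noteq> 0" using assms by (auto simp: power_0_left)
  have "\<alpha> powi i = \<alpha> powi (int n * (i div int n) + i mod int n)" by simp
  also have "\<dots> = (\<alpha> powi int n) powi (i div int n) * \<alpha> powi (i mod int n)"
    using a0 by (simp only: power_int_add power_int_mult simp_thms)
  finally show ?thesis using assms by simp
qed

lemma dihedral_rep_mult:
  assumes \<alpha>: "\<alpha> ^ n = 1" and n: "n > 0"
  shows "dihedral_rep \<alpha> (g \<otimes>\<^bsub>dihedral_group n\<^esub> h) = dihedral_rep \<alpha> g ** dihedral_rep \<alpha> h"
proof -
  have a0: "\<alpha> \<noteq> 0" using assms by (auto simp: power_0_left)
  have \<beta>: "inverse \<alpha> ^ n = 1" using \<alpha> by (simp add: power_inverse)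
  show ?thesis
    by (cases g; cases h)
      (auto simp: vec_eq_iff forall_2 matrix_matrix_mult_def sum_2 dihedral_rep_def dihedral_group_def
        power_int_mod_eq[OF \<alpha> n] power_int_mod_eq[OF \<beta> n] power_int_add power_int_diff a0
        power_int_inverse field_simps)
qed

lemma dihedral_rep_one: "dihedral_rep \<alpha> \<one>\<^bsub>dihedral_group n\<^esub> = mat 1"
  by (simp add: vec_eq_iff forall_2 dihedral_rep_def dihedral_group_def mat_def)

text \<open>
  An element of the group algebra is \<open>p(x) + q(x) y\<close> for unique polynomials \<open>p\<close> and \<open>q\<close> of degree less
  than \<open>n\<close>; these are the cases \<open>b = False\<close> and \<open>b = True\<close>.
\<close>

definition coeff_poly :: "nat \<Rightarrow> (int \<times> bool \<Rightarrow> 'a::field) \<Rightarrow> bool \<Rightarrow> 'a poly" where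
  "coeff_poly n u b = (\<Sum>i<n. monom (u (int i, b)) i)"

lemma coeff_coeff_poly: "coeff (coeff_poly n u b) i = (if i < n then u (int i, b) else 0)"
  by (simp add: coeff_poly_def coeff_sum)

lemma degree_coeff_poly: "n > 0 \<Longrightarrow> degree (coeff_poly n u b) < n"
  by (rule degree_lessI) (auto simp: coeff_coeff_poly)

lemma aeval_coeff_poly:
  "aeval (coeff_poly n u b) x = (\<Sum>i<n. to_ac (u (int i, b)) * x ^ i)"
  by (simp add: coeff_poly_def map_poly_to_ac_hom poly_sum poly_monom)

lemma pairing_dihedral:
  "pairing (dihedral_group n) \<iota> u \<phi> =
    (\<Sum>i<n. \<iota> (u (int i, False)) * \<phi> (int i, False)) + (\<Sum>i<n. \<iota> (u (int i, True)) * \<phi> (int i, True))"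
proof -
  have c: "carrier (dihedral_group n) = {0..<int n} \<times> UNIV" by (simp add: dihedral_group_def)
  have "pairing (dihedral_group n) \<iota> u \<phi> = (\<Sum>i\<in>{0..<int n}. \<Sum>b\<in>UNIV. \<iota> (u (i, b)) * \<phi> (i, b))"
    unfolding pairing_def c by (simp add: sum.cartesian_product)
  also have "{0..<int n} = int ` {..<n}"
    by (simp add: image_int_atLeastLessThan lessThan_atLeast0)
  also have "(\<Sum>i\<in>int ` {..<n}. \<Sum>b\<in>UNIV. \<iota> (u (i, b)) * \<phi> (i, b)) =
      (\<Sum>i<n. \<Sum>b\<in>UNIV. \<iota> (u (int i, b)) * \<phi> (int i, b))"
    by (subst sum.reindex) (simp_all add: inj_on_def)
  finally show ?thesis by (simp add: UNIV_bool sum.distrib add.commute)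
qed

lemma extend_dihedral_rep:
  "extend_rep (dihedral_group n) (dihedral_rep \<alpha>) u =
    (\<chi> r c. aeval (coeff_poly n u (r \<noteq> c)) (if r = 1 then \<alpha> else inverse \<alpha>))"
  by (simp add: vec_eq_iff forall_2 extend_rep_def pairing_dihedral aeval_coeff_poly dihedral_rep_def)

definition dihedral_character :: "'k::field \<Rightarrow> 'k \<Rightarrow> int \<times> bool \<Rightarrow> 'k" where
  "dihedral_character \<epsilon> \<sigma> g = \<epsilon> powi fst g * (if snd g then \<sigma> else 1)"

text \<open>
  Multiplicativity on the reflections needs \<open>\<epsilon>\<close> to be its own inverse.
\<close>

lemma dihedral_character_mult:
  assumes "\<epsilon> ^ n = 1" "n > 0" "\<epsilon> * \<epsilon> = 1" "\<sigma> * \<sigma> = 1"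
  shows "dihedral_character \<epsilon> \<sigma> (g \<otimes>\<^bsub>dihedral_group n\<^esub> h) =
    dihedral_character \<epsilon> \<sigma> g * dihedral_character \<epsilon> \<sigma> h"
proof -
  have e0: "\<epsilon> \<noteq> 0" using assms(3) by auto
  have "inverse \<epsilon> = \<epsilon>" using assms(3) by (rule inverse_unique)
  then have "\<epsilon> powi (i - j) = \<epsilon> powi i * \<epsilon> powi j" for i j
    using e0 power_int_inverse[of \<epsilon> j] by (simp add: power_int_diff divide_inverse)
  then show ?thesis
    using assms(4) by (cases g; cases h)
      (auto simp: dihedral_character_def dihedral_group_def power_int_mod_eq[OF assms(1,2)]
        power_int_add e0 algebra_simps)
qed

lemma pairing_dihedral_character:
  "pairing (dihedral_group n) (\<lambda>a. a) u (dihedral_character \<epsilon> \<sigma>) =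
    poly (coeff_poly n u False) \<epsilon> + \<sigma> * poly (coeff_poly n u True) \<epsilon>"
  by (simp add: pairing_dihedral coeff_poly_def poly_sum poly_monom dihedral_character_def
      sum_distrib_left algebra_simps)

section \<open>Descent of the diagonal representation to the field of the trace\<close>

text \<open>
  Both rows \<open>(1, \<alpha>)\<close> and \<open>(\<alpha>, 1)\<close> are left eigenvectors, for the eigenvalues \<open>\<alpha>\<close> and \<open>\<alpha>^(-1)\<close>, of the
  companion matrix of \<open>X^2 - (\<alpha> + \<alpha>^(-1)) X + 1\<close>, and the transposition swaps them. Conjugating by this
  matrix therefore moves the diagonal representation into matrices over \<open>F[\<alpha> + \<alpha>^(-1)]\<close> and leaves
  the image of \<open>y\<close> unchanged.
\<close>

definition eigen_matrix :: "'k::field \<Rightarrow> 'k^2^2" where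
  "eigen_matrix \<alpha> = (\<chi> r c. if r = c then 1 else \<alpha>)"

definition eigen_matrix_inv :: "'k::field \<Rightarrow> 'k^2^2" where
  "eigen_matrix_inv \<alpha> = (\<chi> r c. (if r = c then 1 else - \<alpha>) / (1 - \<alpha>\<^sup>2))"

text \<open>
  The form of the diagonal representation over the smaller field of \<open>\<alpha> + \<alpha>^(-1)\<close>.
\<close>

definition trace_rep :: "'k::field \<Rightarrow> int \<times> bool \<Rightarrow> 'k^2^2" where
  "trace_rep \<alpha> g = eigen_matrix_inv \<alpha> ** dihedral_rep \<alpha> g ** eigen_matrix \<alpha>"

lemma eigen_matrix_inverse:
  assumes "\<alpha>\<^sup>2 \<noteq> 1"
  shows "eigen_matrix \<alpha> ** eigen_matrix_inv \<alpha> = mat 1"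
    and "eigen_matrix_inv \<alpha> ** eigen_matrix \<alpha> = mat 1"
proof -
  have "1 - \<alpha>\<^sup>2 \<noteq> 0" using assms by simp
  then show "eigen_matrix \<alpha> ** eigen_matrix_inv \<alpha> = mat 1"
    and "eigen_matrix_inv \<alpha> ** eigen_matrix \<alpha> = mat 1"
    by (simp_all add: vec_eq_iff forall_2 eigen_matrix_def eigen_matrix_inv_def matrix_matrix_mult_def
        sum_2 mat_def power2_eq_square flip: diff_divide_distrib add_divide_distrib)
qed

lemma trace_rep_product:
  assumes "\<alpha>\<^sup>2 \<noteq> 1" and "dihedral_rep \<alpha> g = dihedral_rep \<alpha> h ** dihedral_rep \<alpha> k"
  shows "trace_rep \<alpha> g = trace_rep \<alpha> h ** trace_rep \<alpha> k"
  unfolding trace_rep_def assms(2)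
  by (metis eigen_matrix_inverse(1)[OF assms(1)] matrix_mul_assoc matrix_mul_rid)

lemma trace_rep_mult:
  assumes "\<alpha> ^ n = 1" "n > 0" "\<alpha>\<^sup>2 \<noteq> 1"
  shows "trace_rep \<alpha> (g \<otimes>\<^bsub>dihedral_group n\<^esub> h) = trace_rep \<alpha> g ** trace_rep \<alpha> h"
  by (rule trace_rep_product[OF assms(3) dihedral_rep_mult[OF assms(1,2)]])

lemma trace_rep_one: "\<alpha>\<^sup>2 \<noteq> 1 \<Longrightarrow> trace_rep \<alpha> \<one>\<^bsub>dihedral_group n\<^esub> = mat 1"
  by (simp add: trace_rep_def dihedral_rep_one eigen_matrix_inverse)

lemma trace_rep_eqI:
  assumes "\<alpha>\<^sup>2 \<noteq> 1" "dihedral_rep \<alpha> g ** eigen_matrix \<alpha> = eigen_matrix \<alpha> ** C"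
  shows "trace_rep \<alpha> g = C"
  unfolding trace_rep_def
  by (metis assms eigen_matrix_inverse(2) matrix_mul_assoc matrix_mul_lid)

text \<open>
  It suffices to look at the generators: \<open>x\<close> goes to the companion matrix \<open>C\<close> and \<open>y\<close> to the
  permutation matrix, both with entries in \<open>F[\<alpha> + \<alpha>^(-1)]\<close>.
\<close>

lemma trace_rep_closed:
  fixes \<alpha> :: "'a::field alg_closure"
  assumes \<alpha>: "\<alpha> ^ n = 1" "n > 0" "\<alpha>\<^sup>2 \<noteq> 1" and g: "g \<in> carrier (dihedral_group n)"
  shows "trace_rep \<alpha> g \<in> carrier (mat2_alg (adjoin (\<alpha> + inverse \<alpha>)))"
proof -
  have a0: "\<alpha> \<noteq> 0" using \<alpha> by (auto simp: power_0_left)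
  let ?R = "carrier (mat2_alg (adjoin (\<alpha> + inverse \<alpha>)))"
  define C :: "'a alg_closure^2^2" where "C = (\<chi> r c. if r = 1 then (if c = 1 then 0 else - 1)
    else (if c = 1 then 1 else \<alpha> + inverse \<alpha>))"
  have rot: "trace_rep \<alpha> (1, False) = C"
    by (rule trace_rep_eqI[OF \<alpha>(3)])
      (simp add: vec_eq_iff forall_2 matrix_matrix_mult_def sum_2 dihedral_rep_def eigen_matrix_def
        C_def a0 algebra_simps)
  have C: "C \<in> ?R" by (simp add: C_def mat2_alg_def)
  have step: "trace_rep \<alpha> (int (Suc i), b) = C ** trace_rep \<alpha> (int i, b)" for i b
  proof -
    have pow: "x powi int (Suc i) = x * x powi int i" for x :: "'a alg_closure"
      by (simp only: power_int_of_nat power_Suc)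
    have "dihedral_rep \<alpha> (int (Suc i), b) = dihedral_rep \<alpha> (1, False) ** dihedral_rep \<alpha> (int i, b)"
      by (simp add: vec_eq_iff forall_2 matrix_matrix_mult_def sum_2 dihedral_rep_def pow
          del: of_nat_Suc power_int_of_nat)
    then show ?thesis unfolding rot[symmetric] by (rule trace_rep_product[OF \<alpha>(3)])
  qed
  have zero: "trace_rep \<alpha> (0, b) = (\<chi> r c. if (r = c) = b then 0 else 1)" for b
    by (rule trace_rep_eqI[OF \<alpha>(3)])
      (simp add: vec_eq_iff forall_2 matrix_matrix_mult_def sum_2 dihedral_rep_def eigen_matrix_def)
  have "trace_rep \<alpha> (int i, b) \<in> ?R" for i b
  proof (induction i)
    case 0
    show ?case by (simp add: zero mat2_alg_def)
  next
    case (Suc i)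
    show ?case unfolding step by (rule mat2_alg_mult_closed[OF C Suc])
  qed
  from this[of "nat (fst g)" "snd g"] show ?thesis
    using g by (auto simp: dihedral_group_def)
qed

section \<open>Gluing quotients that separate values at roots of unity\<close>

lemma poly_eq_0_of_roots_of_unity:
  fixes p :: "'k::alg_closed_field poly"
  assumes n: "(of_nat n :: 'k) \<noteq> 0" and deg: "degree p < n" and roots: "\<And>x. x ^ n = 1 \<Longrightarrow> poly p x = 0"
  shows "p = 0"
proof (rule ccontr)
  assume p: "p \<noteq> 0"
  have "n = card {x::'k. x ^ n = 1}" by (rule card_roots_of_unity[OF n, symmetric])
  also have "\<dots> \<le> card {x. poly p x = 0}"
    by (rule card_mono[OF poly_roots_finite[OF p]]) (use roots in auto)
  also have "\<dots> \<le> degree p" by (rule card_poly_roots_bound[OF p])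
  finally show False using deg by simp
qed

text \<open>
  A zero of \<open>p\<close> at one root of the irreducible \<open>f j\<close> spreads to all roots of \<open>f j\<close>. A zero at
  \<open>inverse (\<alpha> j)\<close> is a zero of the reflected polynomial at \<open>\<alpha> j\<close>, so it spreads to the inverses of
  all roots of \<open>f j\<close>. Altogether \<open>p\<close> vanishes at \<open>n\<close> distinct points, more than its degree permits.
\<close>

lemma eq_0_of_conjugates_cover:
  fixes f :: "'i \<Rightarrow> 'a::field poly"
  assumes n: "(of_nat n :: 'a) \<noteq> 0"
    and irr: "\<And>j. j \<in> I \<Longrightarrow> Factorial_Ring.irreducible (f j)"
    and root: "\<And>j. j \<in> I \<Longrightarrow> aeval (f j) (\<alpha> j) = 0" "\<And>j. j \<in> I \<Longrightarrow> \<alpha> j \<noteq> 0"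
    and cover: "\<And>x. x ^ n = 1 \<Longrightarrow> \<exists>j\<in>I. aeval (f j) x = 0 \<or> aeval (f j) (inverse x) = 0"
    and deg: "degree p < n"
    and p: "\<And>j. j \<in> I \<Longrightarrow> aeval p (\<alpha> j) = 0" "\<And>j. j \<in> I \<Longrightarrow> aeval p (inverse (\<alpha> j)) = 0"
  shows "p = 0"
proof -
  have N: "(of_nat n :: 'a alg_closure) \<noteq> 0"
    using n by (metis to_ac_eq_0_iff to_ac_of_nat)
  have "aeval p x = 0" if x: "x ^ n = 1" for x
  proof -
    have x0: "x \<noteq> 0" using x N by (auto simp: power_0_left split: if_splits)
    obtain j where j: "j \<in> I" and alt: "aeval (f j) x = 0 \<or> aeval (f j) (inverse x) = 0"
      using cover[OF x] by blast
    show ?thesis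
    proof (cases "aeval (f j) x = 0")
      case True
      show ?thesis by (rule common_root_transfer[OF irr[OF j] root(1)[OF j] p(1)[OF j] True])
    next
      case False
      then have inv: "aeval (f j) (inverse x) = 0" using alt by simp
      have "aeval (reflect_poly p) (\<alpha> j) = 0"
        using p(2)[OF j] root(2)[OF j] by (simp add: aeval_reflect_eq_0_iff)
      then have "aeval (reflect_poly p) (inverse x) = 0"
        by (rule common_root_transfer[OF irr[OF j] root(1)[OF j] _ inv])
      then show ?thesis using x0 by (simp add: aeval_reflect_eq_0_iff)
    qed
  qed
  then have "map_poly to_ac p = 0"
    by (intro poly_eq_0_of_roots_of_unity[OF N]) (use deg in \<open>simp_all add: degree_map_poly\<close>)
  then show ?thesis by (simp add: map_poly_eq_0_iff)
qed

text \<open>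
  The two polynomials \<open>coeff_poly n u b\<close> at the two points \<open>\<alpha>\<close> and \<open>\<alpha>^(-1)\<close> are the four entries of the
  image of \<open>u\<close> under the diagonal representation attached to \<open>\<alpha>\<close>. They are all that a block of the
  decomposition knows about \<open>u\<close>, in whichever coordinates the block is written.
\<close>

definition coeff_values_agree ::
    "nat \<Rightarrow> 'a::field alg_closure \<Rightarrow> (int \<times> bool \<Rightarrow> 'a) \<Rightarrow> (int \<times> bool \<Rightarrow> 'a) \<Rightarrow> bool" where
  "coeff_values_agree n \<alpha> u v \<longleftrightarrow>
    (\<forall>b. aeval (coeff_poly n u b) \<alpha> = aeval (coeff_poly n v b) \<alpha> \<and>
      aeval (coeff_poly n u b) (inverse \<alpha>) = aeval (coeff_poly n v b) (inverse \<alpha>))"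

text \<open>
  The only property of a block that the counting argument uses besides its size. Stating it
  as the existence of a homomorphism hides the different element types and coordinates of the three
  kinds of blocks.
\<close>

definition separating_quotient :: "nat \<Rightarrow> 'a::field alg_closure \<Rightarrow> ('a, 'b) alg \<Rightarrow> bool" where
  "separating_quotient n \<alpha> A \<longleftrightarrow>
    (\<exists>\<Phi> \<in> alg_hom (group_algebra (dihedral_group n)) A.
      \<forall>u v. \<Phi> u = \<Phi> v \<longrightarrow> coeff_values_agree n \<alpha> u v)"

lemma separating_quotientI:
  assumes "\<Phi> \<in> alg_hom (group_algebra (dihedral_group n)) A"
    and "\<And>u v. \<Phi> u = \<Phi> v \<Longrightarrow> coeff_values_agree n \<alpha> u v"
  shows "separating_quotient n \<alpha> A"
  unfolding separating_quotient_def using assms by blast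

lemma separating_quotient_copy:
  assumes e: "inj e" and sep: "separating_quotient n \<alpha> A"
  shows "separating_quotient n \<alpha> (alg_copy e A)"
proof -
  obtain \<Phi> where \<Phi>: "\<Phi> \<in> alg_hom (group_algebra (dihedral_group n)) A"
    and agree: "\<And>u v. \<Phi> u = \<Phi> v \<Longrightarrow> coeff_values_agree n \<alpha> u v"
    using sep unfolding separating_quotient_def by blast
  show ?thesis
  proof (rule separating_quotientI[OF alg_hom_copy[OF e \<Phi>]])
    fix u v assume "(e \<circ> \<Phi>) u = (e \<circ> \<Phi>) v"
    then have "\<Phi> u = \<Phi> v" using injD[OF e] by simp
    then show "coeff_values_agree n \<alpha> u v" by (rule agree)
  qed
qed

lemma aeval_to_ac: "aeval p (to_ac c) = to_ac (poly p c)"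
  by (induction p) (simp_all add: map_poly_pCons)

lemma two_eq_0_iff_CHAR: "(2::'a::field) = 0 \<longleftrightarrow> CHAR('a) = 2"
proof
  assume "(2::'a) = 0"
  then have "CHAR('a) dvd 2" using of_nat_eq_0_iff_char_dvd[of 2, where ?'a = 'a] by simp
  moreover have "CHAR('a) \<noteq> 1" by simp
  ultimately show "CHAR('a) = 2" using two_is_prime_nat unfolding prime_nat_iff by blast
next
  assume "CHAR('a) = 2"
  then show "(2::'a) = 0" using of_nat_CHAR[where ?'a = 'a] by simp
qed

text \<open>
  The block of \<open>\<epsilon> = \<plusminus>1\<close> comes from the two characters with \<open>x \<mapsto> \<epsilon>\<close> and \<open>y \<mapsto> \<plusminus>1\<close>. On \<open>a(x) + b(x) y\<close>
  they take the values \<open>a(\<epsilon>) \<plusminus> b(\<epsilon>)\<close>, which determine \<open>a(\<epsilon>)\<close> and \<open>b(\<epsilon>)\<close> because \<open>2\<close> is invertible.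
\<close>

lemma separating_quotient_field_sum2:
  fixes \<epsilon> :: "'a::field"
  assumes n: "n > 0" and char: "CHAR('a) \<noteq> 2" and \<epsilon>: "\<epsilon> ^ n = 1" "\<epsilon> * \<epsilon> = 1"
  shows "separating_quotient n (to_ac \<epsilon>) (field_sum2 :: ('a, 'a \<times> 'a) alg)"
proof -
  let ?G = "dihedral_group n"
  let ?\<Phi> = "\<lambda>u. (pairing ?G (\<lambda>a. a) u (dihedral_character \<epsilon> 1), pairing ?G (\<lambda>a. a) u (dihedral_character \<epsilon> (-1)))"
  have \<Phi>: "?\<Phi> \<in> alg_hom (group_algebra ?G) field_sum2"
    by (rule character_pair_alg_hom[OF group_dihedral_group[OF n] finite_dihedral_group])
      (simp_all add: dihedral_character_mult[OF \<epsilon>(1) n \<epsilon>(2)],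
       simp_all add: dihedral_character_def dihedral_group_def)
  have two: "(2::'a) \<noteq> 0" using char by (simp add: two_eq_0_iff_CHAR)
  have inv: "inverse (to_ac \<epsilon>) = to_ac \<epsilon>"
    using inverse_unique[OF \<epsilon>(2)] by (metis to_ac_inverse)
  show ?thesis
  proof (rule separating_quotientI[OF \<Phi>])
    fix u v assume eq: "?\<Phi> u = ?\<Phi> v"
    let ?x = "\<lambda>b. poly (coeff_poly n u b) \<epsilon>" and ?y = "\<lambda>b. poly (coeff_poly n v b) \<epsilon>"
    have s: "?x False + ?x True = ?y False + ?y True" and d: "?x False - ?x True = ?y False - ?y True"
      using eq by (simp_all add: pairing_dihedral_character)
    have "2 * ?x False = (?x False + ?x True) + (?x False - ?x True)" by simp
    also have "\<dots> = 2 * ?y False" unfolding s d by simp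
    finally have F: "?x False = ?y False" using two by simp
    with s have "?x True = ?y True" by simp
    with F have "?x b = ?y b" for b by (cases b) simp_all
    then show "coeff_values_agree n (to_ac \<epsilon>) u v"
      by (simp only: coeff_values_agree_def inv aeval_to_ac simp_thms)
  qed
qed

text \<open>
  In characteristic 2 the two characters coincide. The quotient that keeps both \<open>a(1)\<close> and \<open>b(1)\<close> is
  the one by \<open>x = 1\<close>, that is, the group algebra of the group generated by \<open>y\<close>.
\<close>

lemma separating_quotient_field_C2:
  assumes n: "n > 0"
  shows "separating_quotient n 1 (field_C2 :: ('a::field, 'a \<times> 'a) alg)"
proof -
  let ?G = "dihedral_group n"
  let ?\<phi> = "\<lambda>b (g :: int \<times> bool). if snd g = b then 1 else 0 :: 'a"
  let ?\<Phi> = "\<lambda>u. (pairing ?G (\<lambda>a. a) u (?\<phi> False), pairing ?G (\<lambda>a. a) u (?\<phi> True))"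
  have \<Phi>: "?\<Phi> \<in> alg_hom (group_algebra ?G) field_C2"
    by (rule parity_pair_alg_hom[OF group_dihedral_group[OF n] finite_dihedral_group])
      (auto simp: dihedral_group_def)
  have val: "pairing ?G (\<lambda>a. a) u (?\<phi> b) = poly (coeff_poly n u b) 1" for u b
    by (cases b) (simp_all add: pairing_dihedral coeff_poly_def poly_sum poly_monom)
  have eq: "?\<Phi> u = ?\<Phi> v \<longleftrightarrow> (\<forall>b. poly (coeff_poly n u b) 1 = poly (coeff_poly n v b) 1)" for u v
    unfolding prod.inject val all_bool_eq by blast
  have one: "aeval p 1 = to_ac (poly p 1)" for p :: "'a poly" using aeval_to_ac[of p 1] by simp
  show ?thesis
  proof (rule separating_quotientI[OF \<Phi>])
    fix u v assume "?\<Phi> u = ?\<Phi> v"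
    then have "poly (coeff_poly n u b) 1 = poly (coeff_poly n v b) 1" for b unfolding eq by blast
    then show "coeff_values_agree n 1 u v" by (simp only: coeff_values_agree_def inverse_1 one simp_thms)
  qed
qed

lemma extend_dihedral_rep_eqD:
  assumes "extend_rep (dihedral_group n) (dihedral_rep \<alpha>) u = extend_rep (dihedral_group n) (dihedral_rep \<alpha>) v"
  shows "coeff_values_agree n \<alpha> u v"
  using assms
  by (simp add: coeff_values_agree_def extend_dihedral_rep vec_eq_iff forall_2 all_bool_eq)

lemma inverse_in_adjoin:
  assumes "\<alpha> ^ n = 1" and "n > 0"
  shows "inverse \<alpha> \<in> adjoin \<alpha>"
proof -
  have "inverse \<alpha> = \<alpha> ^ (n - 1)" using assms by (intro inverse_unique) (simp add: power_eq_if)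
  also have "\<dots> = aeval ([:0, 1:] ^ (n - 1)) \<alpha>" by (simp add: map_poly_to_ac_hom)
  finally show ?thesis using adjoinI by metis
qed

lemma adjoin_power_closed: "x \<in> adjoin \<beta> \<Longrightarrow> x ^ k \<in> adjoin \<beta>"
  by (induction k) (simp_all add: adjoin_mult_closed)

lemma separating_quotient_mat2_adjoin:
  fixes \<alpha> :: "'a::field alg_closure"
  assumes \<alpha>: "\<alpha> ^ n = 1" and n: "n > 0"
  shows "separating_quotient n \<alpha> (mat2_alg (adjoin \<alpha>))"
proof -
  let ?G = "dihedral_group n"
  have closed: "dihedral_rep \<alpha> g \<in> carrier (mat2_alg (adjoin \<alpha>))" if g: "g \<in> carrier ?G" for g
  proof -
    obtain i where "g = (int i, snd g)" using g by (rule dihedral_carrierE)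
    then have "fst g = int i" by (metis fst_conv)
    then show ?thesis
      using inverse_in_adjoin[OF \<alpha> n]
      by (simp add: mat2_alg_def dihedral_rep_def adjoin_power_closed)
  qed
  have \<Phi>: "extend_rep ?G (dihedral_rep \<alpha>) \<in> alg_hom (group_algebra ?G) (mat2_alg (adjoin \<alpha>))"
    by (rule extend_rep_alg_hom[OF group_dihedral_group[OF n] finite_dihedral_group closed
          dihedral_rep_mult[OF \<alpha> n] dihedral_rep_one])
  show ?thesis by (rule separating_quotientI[OF \<Phi> extend_dihedral_rep_eqD])
qed

text \<open>
  The matrices over the smaller field determine the diagonal representation by undoing the
  conjugation, although the conjugating matrix itself is not defined over that field.
\<close>

lemma separating_quotient_mat2_trace:
  fixes \<alpha> :: "'a::field alg_closure"
  assumes \<alpha>: "\<alpha> ^ n = 1" and n: "n > 0" and ne: "\<alpha>\<^sup>2 \<noteq> 1"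
  shows "separating_quotient n \<alpha> (mat2_alg (adjoin (\<alpha> + inverse \<alpha>)))"
proof -
  let ?G = "dihedral_group n"
  have \<Phi>: "extend_rep ?G (trace_rep \<alpha>) \<in> alg_hom (group_algebra ?G) (mat2_alg (adjoin (\<alpha> + inverse \<alpha>)))"
    by (rule extend_rep_alg_hom[OF group_dihedral_group[OF n] finite_dihedral_group
          trace_rep_closed[OF \<alpha> n ne] trace_rep_mult[OF \<alpha> n ne] trace_rep_one[OF ne]])
  have conj: "extend_rep ?G (trace_rep \<alpha>) u =
      eigen_matrix_inv \<alpha> ** extend_rep ?G (dihedral_rep \<alpha>) u ** eigen_matrix \<alpha>" for u
    unfolding trace_rep_def[abs_def] by (rule extend_rep_conjugate)
  have undo: "extend_rep ?G (dihedral_rep \<alpha>) u =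
      eigen_matrix \<alpha> ** extend_rep ?G (trace_rep \<alpha>) u ** eigen_matrix_inv \<alpha>" for u
  proof -
    have "eigen_matrix \<alpha> ** extend_rep ?G (trace_rep \<alpha>) u ** eigen_matrix_inv \<alpha> =
        (eigen_matrix \<alpha> ** eigen_matrix_inv \<alpha>) ** extend_rep ?G (dihedral_rep \<alpha>) u **
          (eigen_matrix \<alpha> ** eigen_matrix_inv \<alpha>)"
      unfolding conj by (simp only: matrix_mul_assoc)
    then show ?thesis by (simp add: eigen_matrix_inverse[OF ne])
  qed
  show ?thesis
  proof (rule separating_quotientI[OF \<Phi>])
    fix u v assume eq: "extend_rep ?G (trace_rep \<alpha>) u = extend_rep ?G (trace_rep \<alpha>) v"
    have "extend_rep ?G (dihedral_rep \<alpha>) u = extend_rep ?G (dihedral_rep \<alpha>) v"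
      unfolding undo eq ..
    then show "coeff_values_agree n \<alpha> u v" by (rule extend_dihedral_rep_eqD)
  qed
qed

lemma card_group_algebra:
  assumes "finite (carrier G)"
  shows "card (carrier (group_algebra G :: ('a::{field, finite}, 'g \<Rightarrow> 'a) alg)) =
    CARD('a) ^ card (carrier G)"
proof -
  have "carrier (group_algebra G :: ('a, 'g \<Rightarrow> 'a) alg) = (carrier G \<rightarrow>\<^sub>E UNIV)"
    using assms by (auto simp: group_algebra_def)
  then show ?thesis using assms by (simp add: card_PiE)
qed

text \<open>
  The product of the block maps is injective because the coefficient polynomials of two elements
  with the same image differ by a polynomial of degree less than \<open>n\<close> to which
  \<open>eq_0_of_conjugates_cover\<close> applies. It is then bijective because its target is no larger than its
  source; this is where the finiteness of the field enters.
\<close>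

lemma group_algebra_iso_alg_sum:
  fixes f :: "'i \<Rightarrow> 'a::{field, finite} poly" and A :: "'i \<Rightarrow> ('a, 'b) alg"
  assumes n: "(of_nat n :: 'a) \<noteq> 0" and I: "finite I"
    and irr: "\<And>j. j \<in> I \<Longrightarrow> Factorial_Ring.irreducible (f j)"
    and root: "\<And>j. j \<in> I \<Longrightarrow> aeval (f j) (\<alpha> j) = 0" "\<And>j. j \<in> I \<Longrightarrow> \<alpha> j \<noteq> 0"
    and cover: "\<And>x. x ^ n = 1 \<Longrightarrow> \<exists>j\<in>I. aeval (f j) x = 0 \<or> aeval (f j) (inverse x) = 0"
    and sep: "\<And>j. j \<in> I \<Longrightarrow> separating_quotient n (\<alpha> j) (A j)"
    and fin: "\<And>j. j \<in> I \<Longrightarrow> finite (carrier (A j))"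
    and card: "\<And>j. j \<in> I \<Longrightarrow> card (carrier (A j)) \<le> CARD('a) ^ D j"
    and dim: "sum D I = 2 * n"
  shows "(group_algebra (dihedral_group n) :: ('a, int \<times> bool \<Rightarrow> 'a) alg) \<cong>\<^sub>a alg_sum I A"
proof -
  let ?S = "group_algebra (dihedral_group n) :: ('a, int \<times> bool \<Rightarrow> 'a) alg"
  have n0: "n > 0" using n by (cases n) auto
  obtain \<Phi> where \<Phi>: "\<And>j. j \<in> I \<Longrightarrow> \<Phi> j \<in> alg_hom ?S (A j)"
    and agree: "\<And>j u v. j \<in> I \<Longrightarrow> \<Phi> j u = \<Phi> j v \<Longrightarrow> coeff_values_agree n (\<alpha> j) u v"
    using bchoice[of I "\<lambda>j \<Phi>. \<Phi> \<in> alg_hom ?S (A j) \<and>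
      (\<forall>u v. \<Phi> u = \<Phi> v \<longrightarrow> coeff_values_agree n (\<alpha> j) u v)"]
      sep unfolding separating_quotient_def by blast
  let ?\<Phi> = "\<lambda>u. \<lambda>j\<in>I. \<Phi> j u"
  have inj: "inj_on ?\<Phi> (carrier ?S)"
  proof (rule inj_onI)
    fix u v assume u: "u \<in> carrier ?S" and v: "v \<in> carrier ?S" and eq: "?\<Phi> u = ?\<Phi> v"
    have \<Phi>eq: "\<Phi> j u = \<Phi> j v" if "j \<in> I" for j using fun_cong[OF eq, of j] that by simp
    have poly_eq: "coeff_poly n u b = coeff_poly n v b" for b
    proof -
      have "coeff_poly n u b - coeff_poly n v b = 0"
      proof (rule eq_0_of_conjugates_cover[OF n irr root cover])
        show "degree (coeff_poly n u b - coeff_poly n v b) < n"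
          using degree_coeff_poly[OF n0] by (intro degree_diff_less)
      next
        fix j assume j: "j \<in> I"
        from agree[OF j \<Phi>eq[OF j]]
        show "aeval (coeff_poly n u b - coeff_poly n v b) (\<alpha> j) = 0"
          and "aeval (coeff_poly n u b - coeff_poly n v b) (inverse (\<alpha> j)) = 0"
          unfolding coeff_values_agree_def map_poly_to_ac_diff by simp_all
      qed
      then show ?thesis by simp
    qed
    show "u = v"
    proof (rule extensionalityI)
      show "u \<in> extensional (carrier (dihedral_group n))" "v \<in> extensional (carrier (dihedral_group n))"
        using u v by (auto simp: group_algebra_def PiE_def)
      fix g assume g: "g \<in> carrier (dihedral_group n)"
      then obtain i where i: "g = (int i, snd g)" "i < n" by (rule dihedral_carrierE)
      have "u (int i, snd g) = v (int i, snd g)"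
        using arg_cong[OF poly_eq[of "snd g"], of "\<lambda>p. coeff p i"] i by (simp add: coeff_coeff_poly)
      then show "u g = v g" using i(1) by metis
    qed
  qed
  have carrier: "carrier (alg_sum I A) = (\<Pi>\<^sub>E j\<in>I. carrier (A j))" by (simp add: alg_sum_def)
  have "card (carrier (alg_sum I A)) = (\<Prod>j\<in>I. card (carrier (A j)))"
    unfolding carrier using I by (rule card_PiE)
  also have "\<dots> \<le> (\<Prod>j\<in>I. CARD('a) ^ D j)" by (intro prod_mono) (use card in auto)
  also have "\<dots> = CARD('a) ^ (2 * n)" unfolding dim[symmetric] power_sum ..
  also have "2 * n = card (carrier (dihedral_group n))" by (simp add: dihedral_group_def)
  also have "CARD('a) ^ \<dots> = card (carrier ?S)"
    by (rule card_group_algebra[OF finite_dihedral_group, symmetric])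
  finally have le: "card (carrier (alg_sum I A)) \<le> card (carrier ?S)" .
  show ?thesis
    by (rule alg_iso_of_card_le[OF alg_hom_sum[OF \<Phi>] inj _ le])
      (use I fin in \<open>auto simp: carrier intro: finite_PiE\<close>)
qed

section \<open>The decomposition attached to a factorization of \<open>x^n - 1\<close>\<close>

lemma alg_copy_carrier: "carrier (alg_copy e A) = e ` carrier A"
  by (simp add: alg_copy_def)

lemma finite_card_copy:
  assumes "finite (carrier A)" "card (carrier A) \<le> m"
  shows "finite (carrier (alg_copy e A))" and "card (carrier (alg_copy e A)) \<le> m"
  using assms card_image_le[of "carrier A" e] by (auto simp: alg_copy_carrier)

locale dihedral_roots =
  fixes n r s :: nat and f :: "nat \<Rightarrow> 'a::{field, finite} poly" and \<alpha> :: "nat \<Rightarrow> 'a alg_closure"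
  assumes n_pos: "n > 0" and coprime: "coprime n CARD('a)"
    and factorization: "dihedral_factorization n r s f"
    and root: "\<And>j. j \<in> {1..r+s} \<Longrightarrow> aeval (f j) (\<alpha> j) = 0"
begin

lemma of_nat_n: "(of_nat n :: 'a) \<noteq> 0"
proof
  assume "(of_nat n :: 'a) = 0"
  then have "CHAR('a) dvd n" by (simp add: of_nat_eq_0_iff_char_dvd)
  moreover have "CHAR('a) dvd CARD('a)" by (rule CHAR_dvd_CARD)
  ultimately have "CHAR('a) dvd 1" using coprime by (metis coprime_common_divisor is_unit_gcd_iff)
  then show False by simp
qed

lemma factor_irreducible: "j \<in> {1..r+s} \<Longrightarrow> Factorial_Ring.irreducible (f j)"
  and f_1: "f 1 = [:-1, 1:]" and f_2: "even n \<Longrightarrow> f 2 = [:1, 1:]" and r_pos: "1 \<le> r"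
  and self_reciprocal: "j \<in> {2..r} \<Longrightarrow> monic_reciprocal (f j) = f j"
  and factors: "[:0, 1:] ^ n - 1 = (\<Prod>j\<in>{1..r}. f j) * (\<Prod>j\<in>{r+1..r+s}. f j * monic_reciprocal (f j))"
  using factorization unfolding dihedral_factorization_def by blast+

lemma f_nonzero: "j \<in> {1..r+s} \<Longrightarrow> f j \<noteq> 0"
  using factor_irreducible by fastforce

lemma f_dvd: assumes "j \<in> {1..r+s}" shows "f j dvd [:0, 1:] ^ n - 1"
proof (cases "j \<le> r")
  case True
  then have "f j dvd (\<Prod>j\<in>{1..r}. f j)" using assms by (intro dvd_prodI) auto
  then show ?thesis unfolding factors by (rule dvd_mult2)
next
  case False
  then have "f j * monic_reciprocal (f j) dvd (\<Prod>j\<in>{r+1..r+s}. f j * monic_reciprocal (f j))"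
    using assms by (intro dvd_prodI) auto
  then show ?thesis unfolding factors by (intro dvd_mult) (rule dvd_mult_left)
qed

lemma root_of_unity: assumes "j \<in> {1..r+s}" shows "\<alpha> j ^ n = 1"
proof -
  obtain c where c: "[:0, 1:] ^ n - 1 = f j * c" using f_dvd[OF assms] by (rule dvdE)
  have "aeval ([:0, 1:] ^ n - 1) (\<alpha> j) = 0" unfolding c by (simp add: map_poly_to_ac_mult root[OF assms])
  then show ?thesis by (simp add: map_poly_to_ac_root_of_unity)
qed

lemma root_nonzero: "j \<in> {1..r+s} \<Longrightarrow> \<alpha> j \<noteq> 0"
  using root_of_unity n_pos by (fastforce simp: power_0_left)

lemma f_coeff_0: assumes "j \<in> {1..r+s}" shows "coeff (f j) 0 \<noteq> 0"
proof
  assume "coeff (f j) 0 = 0"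
  then have "poly (f j) 0 = 0" by (simp add: poly_0_coeff_0)
  moreover obtain c where "[:0, 1:] ^ n - 1 = f j * c" using f_dvd[OF assms] by (rule dvdE)
  then have "poly ([:0, 1:] ^ n - 1) 0 = poly (f j) 0 * poly c 0" by simp
  ultimately show False using n_pos by (simp add: power_0_left)
qed

text \<open>
  A common root of two of the self-reciprocal factors would be a double root of \<open>x^n - 1\<close>.
\<close>

lemma roots_distinct:
  assumes "i \<in> {1..r}" "j \<in> {1..r}" "i \<noteq> j" shows "\<alpha> i \<noteq> \<alpha> j"
proof
  assume eq: "\<alpha> i = \<alpha> j"
  let ?m = "map_poly to_ac :: 'a poly \<Rightarrow> _"
  have "(\<Prod>j\<in>{1..r}. f j) = f i * (f j * (\<Prod>k\<in>{1..r} - {i} - {j}. f k))"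
    using assms by (simp add: prod.remove[of _ i] prod.remove[of _ j])
  then have "[:0, 1:] ^ n - 1 = f i * (f j * ((\<Prod>k\<in>{1..r} - {i} - {j}. f k) *
      (\<Prod>j\<in>{r+1..r+s}. f j * monic_reciprocal (f j))))"
    unfolding factors by (simp only: mult.assoc)
  then obtain c where "[:0, 1:] ^ n - 1 = f i * (f j * c)" by blast
  then have "?m ([:0, 1:] ^ n - 1) = ?m (f i) * (?m (f j) * ?m c)"
    by (simp only: map_poly_to_ac_mult)
  then have m: "[:0, 1:] ^ n - 1 = ?m (f i) * (?m (f j) * ?m c)"
    by (simp only: map_poly_to_ac_root_of_unity)
  have "(of_nat n :: 'a alg_closure) \<noteq> 0" using of_nat_n by (metis to_ac_eq_0_iff to_ac_of_nat)
  then have "poly (?m (f j) * ?m c) (\<alpha> i) \<noteq> 0"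
    by (rule root_of_unity_simple_root[OF m]) (use root assms in simp)
  then show False using root[of j] assms unfolding eq by simp
qed

text \<open>
  This makes \<open>\<alpha> j\<close> and its inverse conjugate, which halves the field over which the block is defined.
\<close>

lemma inverse_root_of_self_reciprocal: assumes "j \<in> {2..r}" shows "aeval (f j) (inverse (\<alpha> j)) = 0"
proof -
  have j: "j \<in> {1..r+s}" using assms by auto
  have "aeval (monic_reciprocal (f j)) (\<alpha> j) = 0" using root[OF j] self_reciprocal[OF assms] by simp
  then show ?thesis by (simp add: aeval_monic_reciprocal_eq_0_iff f_nonzero[OF j] root_nonzero[OF j])
qed

text \<open>
  The roots of the monic reciprocal of \<open>f j\<close> are the inverses of the roots of \<open>f j\<close>.
\<close>

lemma roots_of_unity_covered:
  assumes "x ^ n = 1"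
  shows "\<exists>j\<in>{1..r+s}. aeval (f j) x = 0 \<or> aeval (f j) (inverse x) = 0"
proof -
  have x0: "x \<noteq> 0" using assms n_pos by (auto simp: power_0_left)
  have "aeval ([:0, 1:] ^ n - 1) x = 0" using assms by (simp add: map_poly_to_ac_root_of_unity)
  then consider j where "j \<in> {1..r}" "aeval (f j) x = 0"
    | j where "j \<in> {r+1..r+s}" "aeval (f j * monic_reciprocal (f j)) x = 0"
    unfolding factors map_poly_to_ac_mult map_poly_to_ac_prod poly_mult poly_prod by auto
  then show ?thesis
  proof cases
    case 1
    then show ?thesis by (intro bexI[of _ j]) auto
  next
    case 2
    then have "j \<in> {1..r+s}" by auto
    with 2(2) show ?thesis
      by (intro bexI[of _ j])
        (simp_all add: map_poly_to_ac_mult aeval_monic_reciprocal_eq_0_iff f_nonzero x0)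
  qed
qed

text \<open>
  The summands are the dimensions of the blocks: \<open>2\<close> or \<open>4 (deg (f j) / 2)\<close> for a self-reciprocal
  factor and \<open>4 deg (f j)\<close> for a reciprocal pair. They add up to the dimension \<open>2 n\<close> of the group algebra.
\<close>

lemma degree_sum: "(\<Sum>j\<in>{1..r+s}. if j \<le> r then 2 * degree (f j) else 4 * degree (f j)) = 2 * n"
proof -
  have rec: "degree (f j * monic_reciprocal (f j)) = 2 * degree (f j)" "f j * monic_reciprocal (f j) \<noteq> 0"
    if "j \<in> {r+1..r+s}" for j
  proof -
    have j: "j \<in> {1..r+s}" using that by auto
    have "monic_reciprocal (f j) \<noteq> 0" using f_nonzero[OF j] by (simp add: monic_reciprocal_def)
    then show "degree (f j * monic_reciprocal (f j)) = 2 * degree (f j)" "f j * monic_reciprocal (f j) \<noteq> 0"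
      using f_nonzero[OF j] by (simp_all add: degree_mult_eq degree_monic_reciprocal f_coeff_0[OF j])
  qed
  have "n = degree ([:0, 1:] ^ n - 1 :: 'a poly)" by (rule degree_X_pow_minus_1[OF n_pos, symmetric])
  also have "\<dots> = degree (\<Prod>j\<in>{1..r}. f j) + degree (\<Prod>j\<in>{r+1..r+s}. f j * monic_reciprocal (f j))"
    unfolding factors by (intro degree_mult_eq) (use f_nonzero rec in auto)
  also have "degree (\<Prod>j\<in>{1..r}. f j) = (\<Sum>j\<in>{1..r}. degree (f j))"
    by (rule degree_prod_sum_eq) (use f_nonzero in auto)
  also have "degree (\<Prod>j\<in>{r+1..r+s}. f j * monic_reciprocal (f j)) = (\<Sum>j\<in>{r+1..r+s}. 2 * degree (f j))"
    by (subst degree_prod_sum_eq) (simp_all add: rec del: mult_eq_0_iff)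
  finally have n: "n = (\<Sum>j\<in>{1..r}. degree (f j)) + (\<Sum>j\<in>{r+1..r+s}. 2 * degree (f j))" .
  have "{1..r+s} = {1..r} \<union> {r+1..r+s}" by auto
  then have "(\<Sum>j\<in>{1..r+s}. if j \<le> r then 2 * degree (f j) else 4 * degree (f j)) =
      (\<Sum>j\<in>{1..r}. 2 * degree (f j)) + (\<Sum>j\<in>{r+1..r+s}. 4 * degree (f j))"
    by (simp add: sum.union_disjoint)
  then show ?thesis by (subst n) (simp add: sum_distrib_left algebra_simps)
qed

lemma split_block_index:
  assumes "j \<in> {1..r+s}" "j \<le> dihedral_delta TYPE('a) n"
  shows "j = 1 \<or> j = 2 \<and> even n \<and> CHAR('a) \<noteq> 2"
  using assms by (auto simp: dihedral_delta_def dihedral_eps_def split: if_splits)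

lemma \<alpha>_1: "\<alpha> 1 = 1"
  using root[of 1] r_pos unfolding f_1 by (simp add: map_poly_pCons)

lemma \<alpha>_2: "even n \<Longrightarrow> 2 \<le> r+s \<Longrightarrow> \<alpha> 2 = - 1"
  using root[of 2] by (simp add: f_2 map_poly_pCons add_eq_0_iff)

text \<open>
  The values \<open>1\<close> and, where it is an \<open>n\<close>-th root of unity different from \<open>1\<close>, \<open>-1\<close> are already taken by the
  linear factors \<open>f 1\<close> and \<open>f 2\<close>.
\<close>

lemma square_ne_1: assumes j: "j \<in> {1..r}" "\<not> j \<le> dihedral_delta TYPE('a) n" shows "(\<alpha> j)\<^sup>2 \<noteq> 1"
proof
  assume "(\<alpha> j)\<^sup>2 = 1"
  then have alt: "\<alpha> j = 1 \<or> \<alpha> j = - 1" by (simp add: power2_eq_1_iff)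
  have j1: "j \<noteq> 1" using j by (auto simp: dihedral_delta_def)
  have "\<alpha> j \<noteq> 1" using roots_distinct[of 1 j] j j1 r_pos \<alpha>_1 by auto
  with alt have m: "\<alpha> j = - 1" "(- 1 :: 'a alg_closure) \<noteq> 1" by auto
  then have "(2 :: 'a alg_closure) \<noteq> 0" by (metis one_add_one add_eq_0_iff)
  then have "CHAR('a) \<noteq> 2" using two_eq_0_iff_CHAR[where ?'a = "'a alg_closure"] by simp
  moreover have "(- 1 :: 'a alg_closure) ^ n = 1" using root_of_unity[of j] j m(1) by auto
  then have "even n" using m(2) by (cases "even n") auto
  ultimately have "dihedral_delta TYPE('a) n = 2" by (simp add: dihedral_delta_def dihedral_eps_def)
  then show False
    using roots_distinct[of 2 j] \<alpha>_2[OF \<open>even n\<close>] j m(1) by auto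
qed

text \<open>
  Each block separates the values at its root, and its size is at most \<open>q^(D j)\<close> for the dimension
  \<open>D j\<close> assigned to it by \<open>degree_sum\<close>. For \<open>j \<le> \<delta>\<close> the factor is linear, which makes the bound
  \<open>q^2\<close> for the block fit.
\<close>

lemma wedderburn_decomposition:
  assumes A: "\<And>j. j \<in> {1..r+s} \<Longrightarrow> A j =
     (if j \<le> dihedral_delta TYPE('a) n then alg_copy Inl (if CHAR('a) = 2 then field_C2 else field_sum2)
      else if j \<le> r then alg_copy Inr (mat2_alg (adjoin (\<alpha> j + inverse (\<alpha> j))))
      else alg_copy Inr (mat2_alg (adjoin (\<alpha> j))))"
  shows "(group_algebra (dihedral_group n) :: ('a, int \<times> bool \<Rightarrow> 'a) alg) \<cong>\<^sub>a
    alg_sum {1..r+s} (A :: nat \<Rightarrow> ('a, ('a \<times> 'a) + 'a alg_closure^2^2) alg)"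
proof -
  let ?D = "\<lambda>j. if j \<le> r then 2 * degree (f j) else 4 * degree (f j)"
  have block: "separating_quotient n (\<alpha> j) (A j) \<and> finite (carrier (A j)) \<and>
      card (carrier (A j)) \<le> CARD('a) ^ ?D j" if j: "j \<in> {1..r+s}" for j
  proof -
    consider "j \<le> dihedral_delta TYPE('a) n" | "\<not> j \<le> dihedral_delta TYPE('a) n" "j \<le> r" | "\<not> j \<le> dihedral_delta TYPE('a) n" "\<not> j \<le> r" by blast
    then show ?thesis
    proof cases
      \<comment> \<open>the commutative blocks, on which \<open>x\<close> acts as \<open>1\<close> or \<open>-1\<close>\<close>
      case 1
      let ?B = "if CHAR('a) = 2 then field_C2 else field_sum2 :: ('a, 'a \<times> 'a) alg"
      have Aj: "A j = alg_copy Inl ?B" using A[OF j] 1 by simp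
      have deg: "degree (f j) = 1" using split_block_index[OF j 1] f_1 f_2 by auto
      have "separating_quotient n (\<alpha> j) ?B"
      proof (cases "CHAR('a) = 2")
        case True
        then have "j = 1" using split_block_index[OF j 1] by simp
        then show ?thesis using True separating_quotient_field_C2[OF n_pos] \<alpha>_1 by simp
      next
        case False
        define \<epsilon> :: 'a where "\<epsilon> = (if j = 1 then 1 else - 1)"
        have \<epsilon>: "\<epsilon> ^ n = 1" "\<epsilon> * \<epsilon> = 1" using split_block_index[OF j 1] by (auto simp: \<epsilon>_def)
        have "\<alpha> j = to_ac \<epsilon>" using split_block_index[OF j 1] j \<alpha>_1 \<alpha>_2 by (auto simp: \<epsilon>_def)
        then show ?thesis using False separating_quotient_field_sum2[OF n_pos False \<epsilon>] by simp
      qed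
      then have sep: "separating_quotient n (\<alpha> j) (A j)" unfolding Aj by (intro separating_quotient_copy) simp_all
      have "carrier ?B = UNIV" by (simp add: field_C2_def field_sum2_def)
      then have "finite (carrier ?B)" "card (carrier ?B) \<le> CARD('a) ^ 2"
        by (simp_all add: power2_eq_square flip: UNIV_Times_UNIV add: card_cartesian_product)
      then have B: "finite (carrier (A j))" "card (carrier (A j)) \<le> CARD('a) ^ 2"
        unfolding Aj by (rule finite_card_copy)+
      have "CARD('a) ^ 2 \<le> CARD('a) ^ ?D j" by (rule power_increasing) (auto simp: deg Suc_le_eq)
      then show ?thesis using sep B by auto
    next
      case 2
      let ?t = "\<alpha> j + inverse (\<alpha> j)"
      have Aj: "A j = alg_copy Inr (mat2_alg (adjoin ?t))" using A[OF j] 2 by simp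
      have sq: "(\<alpha> j)\<^sup>2 \<noteq> 1" using square_ne_1[of j] 2 j by simp
      have "j \<in> {2..r}" using 2 by (auto simp: dihedral_delta_def)
      then have inv: "aeval (f j) (inverse (\<alpha> j)) = 0" by (rule inverse_root_of_self_reciprocal)
      have ne: "\<alpha> j \<noteq> inverse (\<alpha> j)"
        using sq root_nonzero[OF j] by (metis power2_eq_square right_inverse)
      note t = card_adjoin_trace_le[OF factor_irreducible[OF j] root[OF j] inv n_pos root_of_unity[OF j] ne]
      have "card (carrier (mat2_alg (adjoin ?t))) \<le> (card (adjoin ?t) ^ 2) ^ 2"
        using card_mat2_alg_le(2)[OF t(1)] by (simp flip: power_mult)
      also have "\<dots> \<le> (CARD('a) ^ degree (f j)) ^ 2" by (rule power_mono[OF t(2)]) simp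
      also have "\<dots> = CARD('a) ^ ?D j" using 2 by (simp flip: power_mult add: mult.commute)
      finally have le: "card (carrier (mat2_alg (adjoin ?t))) \<le> CARD('a) ^ ?D j" .
      have "separating_quotient n (\<alpha> j) (A j)"
        unfolding Aj
        by (rule separating_quotient_copy[OF inj_Inr
              separating_quotient_mat2_trace[OF root_of_unity[OF j] n_pos sq]])
      then show ?thesis using finite_card_copy[OF card_mat2_alg_le(1)[OF t(1)] le] unfolding Aj by blast
    next
      case 3
      have Aj: "A j = alg_copy Inr (mat2_alg (adjoin (\<alpha> j)))" using A[OF j] 3 by simp
      note t = card_adjoin_le[OF f_nonzero[OF j] root[OF j]]
      have "card (carrier (mat2_alg (adjoin (\<alpha> j)))) \<le> card (adjoin (\<alpha> j)) ^ 4"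
        by (rule card_mat2_alg_le(2)[OF t(1)])
      also have "\<dots> \<le> (CARD('a) ^ degree (f j)) ^ 4" by (rule power_mono[OF t(2)]) simp
      also have "\<dots> = CARD('a) ^ ?D j" using 3 by (simp flip: power_mult add: mult.commute)
      finally have le: "card (carrier (mat2_alg (adjoin (\<alpha> j)))) \<le> CARD('a) ^ ?D j" .
      have "separating_quotient n (\<alpha> j) (A j)"
        unfolding Aj
        by (rule separating_quotient_copy[OF inj_Inr
              separating_quotient_mat2_adjoin[OF root_of_unity[OF j] n_pos]])
      then show ?thesis using finite_card_copy[OF card_mat2_alg_le(1)[OF t(1)] le] unfolding Aj by blast
    qed
  qed
  show ?thesis
    by (rule group_algebra_iso_alg_sum[where f = f and \<alpha> = \<alpha> and D = ?D, OF of_nat_n])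
      (use factor_irreducible root root_nonzero roots_of_unity_covered block degree_sum in \<open>blast | simp\<close>)+
qed

end

theorem theorem3p1:
  fixes q n r s :: nat
    and f :: "nat \<Rightarrow> 'a::{field, finite} poly"
    and \<alpha> :: "nat \<Rightarrow> 'a alg_closure"
  assumes "CARD('a) = q" and "n > 0" and "coprime n q"
    and "dihedral_factorization n r s f"
    and "\<forall>j\<in>{1..r+s}. poly (map_poly to_ac (f j)) (\<alpha> j) = 0"
  shows "(CHAR('a) \<noteq> 2 \<longrightarrow>
      (group_algebra (dihedral_group n) :: ('a, int \<times> bool \<Rightarrow> 'a) alg)
        \<cong>\<^sub>a alg_sum {1..r+s} (wedderburn_component n r \<alpha>)) \<and>
    (CHAR('a) = 2 \<longrightarrow>
      (group_algebra (dihedral_group n) :: ('a, int \<times> bool \<Rightarrow> 'a) alg)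
        \<cong>\<^sub>a alg_sum {1..r+s} ((wedderburn_component n r \<alpha>)(1 := alg_copy Inl field_C2)))"
proof -
  interpret dihedral_roots n r s f \<alpha>
    by (rule dihedral_roots.intro) (use assms in simp_all)
  show ?thesis
  proof (intro conjI impI)
    assume char: "CHAR('a) \<noteq> 2"
    show "(group_algebra (dihedral_group n) :: ('a, int \<times> bool \<Rightarrow> 'a) alg)
        \<cong>\<^sub>a alg_sum {1..r+s} (wedderburn_component n r \<alpha>)"
      by (rule wedderburn_decomposition) (simp add: wedderburn_component_def char)
  next
    assume char: "CHAR('a) = 2"
    have "dihedral_delta TYPE('a) n = 1" using char by (simp add: dihedral_delta_def dihedral_eps_def)
    then show "(group_algebra (dihedral_group n) :: ('a, int \<times> bool \<Rightarrow> 'a) alg)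
        \<cong>\<^sub>a alg_sum {1..r+s} ((wedderburn_component n r \<alpha>)(1 := alg_copy Inl field_C2))"
      by (intro wedderburn_decomposition) (auto simp: wedderburn_component_def char)
  qed
qed

end
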